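(* Let $\mu\in\Delta_m$, $\nu\in\Delta_n$ have positive entries, let $C\in\mathbb R^{m\times n}$ and $\tau>0$. Denote by $(f^k,g^k)_k$ the iterates of the Sinkhorn algorithm, initialized at some $(f^0,g^0)\in\mathbb R^m\times\mathbb R^n$, applied to the entropic optimal transport problem with marginals $\mu,\nu$, cost $C$ and regularization $\tau$. Let $L$ be the number of phases, excluding the stationary final phase, of the cold Sinkhorn dynamics initialized at $(f_0[g^0],g_0[f_0[g^0]])$. (1) There exist constants $T,B$ dependent only on $\mu,\nu$, and $C$ such that $$\forall k\ge T/\tau,\qquad \Psi_\tau(f^k,g^k)-\min\Psi_\tau\le B\,\tau\,(\log 1/\tau)^{2L+1}.$$ (2) Moreover, there exist constants $T',B',B''>0$ dependent only on $\mu,\nu,C$, and $(f^0,g^0)$ such that either $(f_0[g^0],g_0[f_0[g^0]])\in\operatorname{argmin}_{\mathcal F}\Psi_0$ or $$\forall k\le T'/\tau,\qquad \Psi_\tau(f^k,g^k)-\min\Psi_\tau\ge B'-B''\,\tau\,(\log 1/\tau)^{2L+1}.$$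
   Context: $\Delta_N$ is the probability simplex in $\mathbb R^N$; $H(p|q)=\sum_I p_I\log(p_I/q_I)$ is relative entropy. The entropic optimal transport problem is to minimize $\sum_{ij}C_{ij}\pi_{ij}+\tau H(\pi|\mu\otimes\nu)$ over probability distributions $\pi$ on $\{1,\dots,m\}\times\{1,\dots,n\}$ with first marginal $\mu$ and second marginal $\nu$. **Objectives.** $\Psi_0(f,g)=-f^\top\mu-g^\top\nu$ and, for $\tau>0$, $\Psi_\tau(f,g)=\tau\big(\sum_{ij}e^{(-C_{ij}+f_i+g_j)/\tau}\mu_i\nu_j-1\big)-f^\top\mu-g^\top\nu$; $\min\Psi_\tau$ is over $\mathbb R^m\times\mathbb R^n$. **Sinkhorn algorithm.** For $\tau>0$, $f_\tau[g]_i=-\tau\log\sum_j e^{(-C_{ij}+g_j)/\tau}\nu_j$ and $g_\tau[f]_j=-\tau\log\sum_i e^{(-C_{ij}+f_i)/\tau}\mu_i$. From $(f^0,g^0)$: for $k\ge0$ even, $f^{k+1}=f_\tau[g^k]$, $g^{k+1}=g^k$; for $k$ odd, $f^{k+1}=f^k$, $g^{k+1}=g_\tau[f^k]$. **Dual OT polytope.** $\mathcal F=\{(f,g)\in\mathbb R^m\times\mathbb R^n:\ f_i+g_j\le C_{ij}\ \forall i,j\}$; $\partial\mathcal F$ is its Pareto frontier: the set of $(f,g)\in\mathcal F$ such that the only $(f',g')\in\mathcal F$ with $f'_i\ge f_i$ and $g'_j\ge g_j$ for all $i,j$ is $(f,g)$ itself. $\operatorname{argmin}_{\mathcal F}\Psi_0$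 is the set of minimizers of $\Psi_0$ over $\mathcal F$. Also $f_0[g]_i=\min_j (C_{ij}-g_j)$ and $g_0[f]_j=\min_i (C_{ij}-f_i)$; always $(f_0[g],g_0[f_0[g]])\in\partial\mathcal F$. **The vectors $v^*(\mathcal E),w^*(\mathcal E)$.** For $\mathcal E\subset\{1,\dots,m\}\times\{1,\dots,n\}$, $\Delta_{\mathcal E}$ is the set of probability distributions on $\mathcal E$; for $\pi\in\Delta_{\mathcal E}$, $(X_\sharp\pi)_i=\sum_{j:(i,j)\in\mathcal E}\pi_{ij}$ and $(Y_\sharp\pi)_j=\sum_{i:(i,j)\in\mathcal E}\pi_{ij}$. If the bipartite graph on $\{1,\dots,m\}\sqcup\{1,\dots,n\}$ with edge set $\mathcal E$ has no isolated vertex, let $\mu^*(\mathcal E)$ be the minimizer of $H(\bar\mu|\mu)$ over $\bar\mu$ such that there is $Q\in\Delta_{\mathcal E}$ with $X_\sharp Q=\bar\mu$, $Y_\sharp Q=\nu$; let $\nu^*(\mathcal E)$ be the minimizer of $H(\bar\nu|\nu)$ over $\bar\nu$ such that there is $P\in\Delta_{\mathcal E}$ with $X_\sharp P=\mu$, $Y_\sharp P=\bar\nu$; and $v^*(\mathcal E)_i=\log(\mu_i/\mu^*_i(\mathcal E))$, $w^*(\mathcal E)_j=\log(\nu_j/\nu^*_j(\mathcal E))$. **Cold Sinkhorn dynamics.** For $(\bar f^0,\bar g^0)\in\partial\mathcal F$, it is the continuous curve with $f(0)=\bar f^0$, $g(0)=\bar g^0$ and $\frac{d}{dt}f(t)=\bar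 v^\ell$, $\frac{d}{dt}g(t)=\bar w^\ell$ for $t\in[t_\ell,t_{\ell+1})$, $\ell\le L$, where $(t_\ell,\bar v^\ell,\bar w^\ell,\mathcal E^\ell)_{\ell\le L}$ is defined recursively: $t_0=0$, $\mathcal E^0=\{(i,j):\bar f^0_i+\bar g^0_j-C_{ij}=0\}$, $\bar v^0=v^*(\mathcal E^0)$, $\bar w^0=w^*(\mathcal E^0)$; and for $\ell\ge0$, $$t_{\ell+1}=\inf\Big\{t\ge t_\ell:\ \max_{(i,j)\notin\mathcal E^\ell} f_i(t_\ell)+g_j(t_\ell)+(t-t_\ell)(\bar v^\ell_i+\bar w^\ell_j)-C_{ij}\ge0\Big\}.$$ If $t_{\ell+1}<\infty$, then $\mathcal E^{\ell+1}=\{(i,j): f_i(t_\ell)+g_j(t_\ell)+(t_{\ell+1}-t_\ell)(\bar v^\ell_i+\bar w^\ell_j)-C_{ij}=0\}$, $\bar v^{\ell+1}=v^*(\mathcal E^{\ell+1})$, $\bar w^{\ell+1}=w^*(\mathcal E^{\ell+1})$. If $t_{\ell+1}=\infty$, then $L=\ell$ and the sequence stops. Set $t_{L+1}=\infty$. Each interval $[t_\ell,t_{\ell+1})$ is a phase; $[t_L,\infty)$ is the final phase, on which the dynamics is stationary. (All the sets $\mathcal E^\ell$ arising have no isolated vertex, and $L$ is finite with $L+1\le 2^{mn}$.)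
   Formalization: The regularization is restricted to 0 < τ ≤ τ_max for an arbitrary fixed τ_max < 1, on which the constants may also depend; for τ near or above 1 the stated bounds fail because log(1/τ) vanishes or is negative. *)

theory Defs
  imports "HOL-Analysis.Analysis"
begin

definition prob_simplex :: "(real ^ 'n::finite) set" where
  "prob_simplex = {p. (\<forall>i. 0 \<le> p $ i) \<and> (\<Sum>i\<in>UNIV. p $ i) = 1}"

text \<open>The convention \<open>0 log 0 = 0\<close> holds automatically, as \<open>0 * x = 0\<close>.\<close>

definition rel_entropy :: "real ^ 'n::finite \<Rightarrow> real ^ 'n \<Rightarrow> real" where
  "rel_entropy p q = (\<Sum>i\<in>UNIV. p $ i * ln (p $ i / q $ i))"


subsection \<open>Dual objectives and dual polytope\<close>

definition Psi0 :: "real ^ 'm::finite \<Rightarrow> real ^ 'n::finite \<Rightarrow> (real ^ 'm) \<times> (real ^ 'n) \<Rightarrow> real" where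
  "Psi0 \<mu> \<nu> = (\<lambda>(f, g). - (f \<bullet> \<mu>) - g \<bullet> \<nu>)"

definition Psi :: "real ^ 'n::finite ^ 'm::finite \<Rightarrow> real ^ 'm \<Rightarrow> real ^ 'n \<Rightarrow> real
    \<Rightarrow> (real ^ 'm) \<times> (real ^ 'n) \<Rightarrow> real" where
  "Psi C \<mu> \<nu> \<tau> = (\<lambda>(f, g).
     \<tau> * ((\<Sum>i\<in>UNIV. \<Sum>j\<in>UNIV. exp ((- C $ i $ j + f $ i + g $ j) / \<tau>) * \<mu> $ i * \<nu> $ j) - 1)
     - f \<bullet> \<mu> - g \<bullet> \<nu>)"

definition dual_polytope :: "real ^ 'n::finite ^ 'm::finite \<Rightarrow> ((real ^ 'm) \<times> (real ^ 'n)) set" where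
  "dual_polytope C = {(f, g). \<forall>i j. f $ i + g $ j \<le> C $ i $ j}"

definition argmin_Psi0 :: "real ^ 'n::finite ^ 'm::finite \<Rightarrow> real ^ 'm \<Rightarrow> real ^ 'n
    \<Rightarrow> ((real ^ 'm) \<times> (real ^ 'n)) set" where
  "argmin_Psi0 C \<mu> \<nu> = {p. is_arg_min (Psi0 \<mu> \<nu>) (\<lambda>q. q \<in> dual_polytope C) p}"


subsection \<open>Sinkhorn algorithm\<close>

definition f_soft :: "real ^ 'n::finite ^ 'm::finite \<Rightarrow> real ^ 'n \<Rightarrow> real \<Rightarrow> real ^ 'n \<Rightarrow> real ^ 'm" where
  "f_soft C \<nu> \<tau> g = (\<chi> i. - \<tau> * ln (\<Sum>j\<in>UNIV. exp ((- C $ i $ j + g $ j) / \<tau>) * \<nu> $ j))"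

definition g_soft :: "real ^ 'n::finite ^ 'm::finite \<Rightarrow> real ^ 'm \<Rightarrow> real \<Rightarrow> real ^ 'm \<Rightarrow> real ^ 'n" where
  "g_soft C \<mu> \<tau> f = (\<chi> j. - \<tau> * ln (\<Sum>i\<in>UNIV. exp ((- C $ i $ j + f $ i) / \<tau>) * \<mu> $ i))"

primrec sinkhorn :: "real ^ 'n::finite ^ 'm::finite \<Rightarrow> real ^ 'm \<Rightarrow> real ^ 'n \<Rightarrow> real
    \<Rightarrow> (real ^ 'm) \<times> (real ^ 'n) \<Rightarrow> nat \<Rightarrow> (real ^ 'm) \<times> (real ^ 'n)" where
  "sinkhorn C \<mu> \<nu> \<tau> p0 0 = p0"
| "sinkhorn C \<mu> \<nu> \<tau> p0 (Suc k) =
     (let (f, g) = sinkhorn C \<mu> \<nu> \<tau> p0 k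
      in if even k then (f_soft C \<nu> \<tau> g, g) else (f, g_soft C \<mu> \<tau> f))"

definition f_hard :: "real ^ 'n::finite ^ 'm::finite \<Rightarrow> real ^ 'n \<Rightarrow> real ^ 'm" where
  "f_hard C g = (\<chi> i. MIN j. C $ i $ j - g $ j)"

definition g_hard :: "real ^ 'n::finite ^ 'm::finite \<Rightarrow> real ^ 'm \<Rightarrow> real ^ 'n" where
  "g_hard C f = (\<chi> j. MIN i. C $ i $ j - f $ i)"


subsection \<open>Cold Sinkhorn dynamics\<close>

text \<open>Distributions on an edge set \<open>E\<close> are represented by matrices vanishing outside \<open>E\<close>.\<close>

definition dists_on :: "('m::finite \<times> 'n::finite) set \<Rightarrow> (real ^ 'n ^ 'm) set" where
  "dists_on E = {p. (\<forall>i j. 0 \<le> p $ i $ j) \<and> (\<forall>i j. (i, j) \<notin> E \<longrightarrow> p $ i $ j = 0)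
                    \<and> (\<Sum>(i, j)\<in>E. p $ i $ j) = 1}"

definition marginal_X :: "('m::finite \<times> 'n::finite) set \<Rightarrow> real ^ 'n ^ 'm \<Rightarrow> real ^ 'm" where
  "marginal_X E p = (\<chi> i. \<Sum>j\<in>{j. (i, j) \<in> E}. p $ i $ j)"

definition marginal_Y :: "('m::finite \<times> 'n::finite) set \<Rightarrow> real ^ 'n ^ 'm \<Rightarrow> real ^ 'n" where
  "marginal_Y E p = (\<chi> j. \<Sum>i\<in>{i. (i, j) \<in> E}. p $ i $ j)"

text \<open>
  If \<open>\<mu>\<close> and \<open>\<nu>\<close> are positive probability vectors and the bipartite graph with edge set \<open>E\<close> has
  no isolated vertex, the following minimizers exist, are unique (strict convexity) and are
  positive. No meaning is attached to these definitions for other \<open>E\<close>.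
\<close>

definition mu_star :: "real ^ 'm::finite \<Rightarrow> real ^ 'n::finite \<Rightarrow> ('m \<times> 'n) set \<Rightarrow> real ^ 'm" where
  "mu_star \<mu> \<nu> E = arg_min_on (\<lambda>x. rel_entropy x \<mu>)
     {x. \<exists>Q\<in>dists_on E. marginal_X E Q = x \<and> marginal_Y E Q = \<nu>}"

definition nu_star :: "real ^ 'm::finite \<Rightarrow> real ^ 'n::finite \<Rightarrow> ('m \<times> 'n) set \<Rightarrow> real ^ 'n" where
  "nu_star \<mu> \<nu> E = arg_min_on (\<lambda>y. rel_entropy y \<nu>)
     {y. \<exists>P\<in>dists_on E. marginal_X E P = \<mu> \<and> marginal_Y E P = y}"

definition v_star :: "real ^ 'm::finite \<Rightarrow> real ^ 'n::finite \<Rightarrow> ('m \<times> 'n) set \<Rightarrow> real ^ 'm" where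
  "v_star \<mu> \<nu> E = (\<chi> i. ln (\<mu> $ i / mu_star \<mu> \<nu> E $ i))"

definition w_star :: "real ^ 'm::finite \<Rightarrow> real ^ 'n::finite \<Rightarrow> ('m \<times> 'n) set \<Rightarrow> real ^ 'n" where
  "w_star \<mu> \<nu> E = (\<chi> j. ln (\<nu> $ j / nu_star \<mu> \<nu> E $ j))"

definition contact_set :: "real ^ 'n::finite ^ 'm::finite \<Rightarrow> real ^ 'm \<Rightarrow> real ^ 'n \<Rightarrow> ('m \<times> 'n) set" where
  "contact_set C f g = {(i, j). f $ i + g $ j - C $ i $ j = 0}"

text \<open>
  The curve is piecewise affine, so the phases are determined by the triples
  \<open>(t\<^sub>l, f(t\<^sub>l), g(t\<^sub>l))\<close>. The edge set \<open>E\<^sup>l\<close> is the contact set of \<open>(f(t\<^sub>l), g(t\<^sub>l))\<close>.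

  \<open>cold_next_time\<close> is \<open>t\<^sub>l\<^sub>+\<^sub>1\<close> given the triple for \<open>l\<close>. That the maximum over the pairs outside
  \<open>E\<^sup>l\<close> is nonnegative is expressed by an existential quantifier; in particular the
  maximum over the empty set counts as \<open>-\<infinity>\<close>. The infimum of the empty set is \<open>\<infinity>\<close>.
\<close>

definition cold_next_time :: "real ^ 'n::finite ^ 'm::finite \<Rightarrow> real ^ 'm \<Rightarrow> real ^ 'n
    \<Rightarrow> real \<times> (real ^ 'm) \<times> (real ^ 'n) \<Rightarrow> ereal" where
  "cold_next_time C \<mu> \<nu> = (\<lambda>(t, f, g).
     let E = contact_set C f g; v = v_star \<mu> \<nu> E; w = w_star \<mu> \<nu> E
     in Inf (ereal ` {s. t \<le> s \<and>
          (\<exists>i j. (i, j) \<notin> E \<and> f $ i + g $ j + (s - t) * (v $ i + w $ j) - C $ i $ j \<ge> 0)}))"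

definition cold_step :: "real ^ 'n::finite ^ 'm::finite \<Rightarrow> real ^ 'm \<Rightarrow> real ^ 'n
    \<Rightarrow> real \<times> (real ^ 'm) \<times> (real ^ 'n) \<Rightarrow> real \<times> (real ^ 'm) \<times> (real ^ 'n)" where
  "cold_step C \<mu> \<nu> = (\<lambda>(t, f, g).
     let E = contact_set C f g; t' = real_of_ereal (cold_next_time C \<mu> \<nu> (t, f, g))
     in (t', f + (t' - t) *\<^sub>R v_star \<mu> \<nu> E, g + (t' - t) *\<^sub>R w_star \<mu> \<nu> E))"

text \<open>
  The triple at the start of phase \<open>l\<close>. It is meaningful only for \<open>l \<le> L\<close>, where \<open>L\<close> is
  \<open>cold_num_phases\<close> below: \<open>cold_step\<close> is meaningless when the next time is \<open>\<infinity>\<close>.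
\<close>

primrec cold_phase :: "real ^ 'n::finite ^ 'm::finite \<Rightarrow> real ^ 'm \<Rightarrow> real ^ 'n
    \<Rightarrow> (real ^ 'm) \<times> (real ^ 'n) \<Rightarrow> nat \<Rightarrow> real \<times> (real ^ 'm) \<times> (real ^ 'n)" where
  "cold_phase C \<mu> \<nu> p0 0 = (0, p0)"
| "cold_phase C \<mu> \<nu> p0 (Suc l) = cold_step C \<mu> \<nu> (cold_phase C \<mu> \<nu> p0 l)"

text \<open>
  The first index \<open>l\<close> with \<open>t\<^sub>l\<^sub>+\<^sub>1 = \<infinity>\<close>. The phases are numbered from 0 to this index, so it is
  the number of phases not counting the final, stationary one.
\<close>

definition cold_num_phases :: "real ^ 'n::finite ^ 'm::finite \<Rightarrow> real ^ 'm \<Rightarrow> real ^ 'n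
    \<Rightarrow> (real ^ 'm) \<times> (real ^ 'n) \<Rightarrow> nat" where
  "cold_num_phases C \<mu> \<nu> p0 = (LEAST l. cold_next_time C \<mu> \<nu> (cold_phase C \<mu> \<nu> p0 l) = \<infinity>)"

definition cold_init :: "real ^ 'n::finite ^ 'm::finite \<Rightarrow> real ^ 'n \<Rightarrow> (real ^ 'm) \<times> (real ^ 'n)" where
  "cold_init C g = (f_hard C g, g_hard C (f_hard C g))"

end

theory Submission
  imports Defs "HOL-Real_Asymp.Real_Asymp"
begin

text \<open>
  The proof bounds the gap to the minimum by \<open>O(\<tau>)\<close> after \<open>O(1 / \<tau>)\<close> steps, and from below by a
  constant minus \<open>O(\<tau>)\<close> during the first \<open>T' / \<tau>\<close> steps. Both follow from estimates of the progress
  of a single half step.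

  Upper bound. Consider a half step from potentials whose plan \<open>\<pi>\<close> has the exact second marginal \<open>\<nu>\<close>.
  It lowers \<open>Psi\<close> by \<open>\<tau>\<close> times the entropy distance of \<open>\<mu>\<close> to the first marginal of \<open>\<pi>\<close>. If this
  distance is above a constant, the step gains \<open>c * \<tau>\<close>. If it is below the constant, then by
  compactness, and because there are only finitely many edge sets, an exact coupling of \<open>\<mu>\<close> and \<open>\<nu>\<close>
  is carried by the entries of \<open>\<pi>\<close> above some constant \<open>\<eta>\<close>. On such entries the dual constraint is
  active up to \<open>O(\<tau>)\<close>, so the coupling certifies that the gap is already \<open>O(\<tau>)\<close>. This dichotomy is
  \<open>drop_or_near_optimal\<close>. After two steps \<open>Psi\<close> is bounded independently of the initialization, so
  only \<open>O(1 / \<tau>)\<close> steps can gain \<open>c * \<tau>\<close> (\<open>sinkhorn_gap_le\<close>).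

  Lower bound. After two steps the value of \<open>Psi\<close> is at least that of \<open>Psi0\<close> at the cold
  initialization, up to \<open>O(\<tau>)\<close>, because soft and hard updates differ by \<open>O(\<tau>)\<close>. From then on no step
  gains more than \<open>O(\<tau>)\<close>. If the cold initialization is not optimal, a fixed fraction of its gap
  survives for \<open>T' / \<tau>\<close> steps (\<open>sinkhorn_gap_ge\<close>).

  It remains to replace the error \<open>\<tau>\<close> by \<open>\<tau> * ln (1 / \<tau>) ^ (2 * L + 1)\<close>, with \<open>L\<close> phases:
  since \<open>ln (1 / \<tau>)\<close> may be less than 1, this costs a constant that is uniform in the
  initialization only if \<open>L\<close> is bounded. Along the cold dynamics the entropy of the projection
  \<open>mu_star\<close> strictly decreases from phase to phase (\<open>cold_phase_advance\<close>), so the contact sets never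
  repeat and \<open>L\<close> is at most the number of edge sets (\<open>cold_num_phases_le\<close>).
\<close>

section \<open>Probability vectors, couplings and half steps\<close>

definition pos_prob :: "real ^ 'n::finite \<Rightarrow> bool" where
  "pos_prob p \<longleftrightarrow> p \<in> prob_simplex \<and> (\<forall>i. 0 < p $ i)"

definition couplings :: "real ^ 'm::finite \<Rightarrow> real ^ 'n::finite \<Rightarrow> (real ^ 'n ^ 'm) set" where
  "couplings \<mu> \<nu> = {P. (\<forall>i j. 0 \<le> P $ i $ j) \<and> (\<forall>i. (\<Sum>j\<in>UNIV. P $ i $ j) = \<mu> $ i)
                     \<and> (\<forall>j. (\<Sum>i\<in>UNIV. P $ i $ j) = \<nu> $ j)}"

text \<open>
  A crude common bound for all the values \<open>- ln (p $ i)\<close>; times \<open>\<tau>\<close>, it bounds the distance between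
  soft and hard updates.
\<close>

definition total_surprisal :: "real ^ 'n::finite \<Rightarrow> real" where
  "total_surprisal p = (\<Sum>i\<in>UNIV. - ln (p $ i))"

lemma MIN_attained:
  fixes h :: "'a::finite \<Rightarrow> real"
  shows "\<exists>i. (MIN i. h i) = h i"
proof -
  have "Min (range h) \<in> range h" by (rule Min_in) auto
  then show ?thesis by (rule imageE) (rule exI)
qed

lemma pos_prob_pos: "pos_prob p \<Longrightarrow> 0 < p $ i"
  by (simp add: pos_prob_def)

lemma pos_prob_sum: "pos_prob p \<Longrightarrow> (\<Sum>i\<in>UNIV. p $ i) = 1"
  by (simp add: pos_prob_def prob_simplex_def)

lemma pos_prob_le_1:
  assumes "pos_prob p" shows "p $ i \<le> 1"
proof -
  have "p $ i \<le> (\<Sum>i\<in>UNIV. p $ i)"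
    by (rule member_le_sum) (use assms pos_prob_pos[OF assms] in \<open>auto intro: less_imp_le\<close>)
  then show ?thesis using pos_prob_sum[OF assms] by simp
qed

lemma surprisal_le_total:
  assumes "pos_prob p" shows "- ln (p $ i) \<le> total_surprisal p"
  unfolding total_surprisal_def
  by (rule member_le_sum) (use pos_prob_pos[OF assms] pos_prob_le_1[OF assms] in auto)

lemma total_surprisal_nonneg:
  assumes "pos_prob p" shows "0 \<le> total_surprisal p"
  unfolding total_surprisal_def
  by (rule sum_nonneg) (use pos_prob_pos[OF assms] pos_prob_le_1[OF assms] in auto)

lemma pos_prob_avg_le:
  assumes "pos_prob p" and "\<And>i. x i \<le> (b::real)"
  shows "(\<Sum>i\<in>UNIV. x i * p $ i) \<le> b"
proof -
  have "(\<Sum>i\<in>UNIV. x i * p $ i) \<le> (\<Sum>i\<in>UNIV. b * p $ i)"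
    using assms(2) pos_prob_pos[OF assms(1)] by (intro sum_mono mult_right_mono) (auto intro: less_imp_le)
  also have "\<dots> = b" using pos_prob_sum[OF assms(1)] by (simp flip: sum_distrib_left)
  finally show ?thesis .
qed

lemma product_coupling:
  assumes "pos_prob \<mu>" "pos_prob \<nu>"
  shows "(\<chi> i j. \<mu> $ i * \<nu> $ j) \<in> couplings \<mu> \<nu>"
  using pos_prob_pos[OF assms(1)] pos_prob_pos[OF assms(2)] pos_prob_sum[OF assms(1)] pos_prob_sum[OF assms(2)]
  by (auto simp: couplings_def less_imp_le simp flip: sum_distrib_left sum_distrib_right)

lemma coupling_sum_potentials:
  assumes "P \<in> couplings \<mu> \<nu>"
  shows "(\<Sum>i\<in>UNIV. \<Sum>j\<in>UNIV. P $ i $ j * (f $ i + g $ j)) = f \<bullet> \<mu> + g \<bullet> \<nu>"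
proof -
  have "(\<Sum>i\<in>UNIV. \<Sum>j\<in>UNIV. P $ i $ j * (f $ i + g $ j)) =
     (\<Sum>i\<in>UNIV. (\<Sum>j\<in>UNIV. P $ i $ j) * f $ i) + (\<Sum>i\<in>UNIV. \<Sum>j\<in>UNIV. P $ i $ j * g $ j)"
    by (simp add: distrib_left sum.distrib sum_distrib_right)
  also have "(\<Sum>i\<in>UNIV. \<Sum>j\<in>UNIV. P $ i $ j * g $ j) = (\<Sum>j\<in>UNIV. (\<Sum>i\<in>UNIV. P $ i $ j) * g $ j)"
    by (subst sum.swap) (simp add: sum_distrib_right)
  finally show ?thesis
    using assms by (simp add: couplings_def inner_vec_def mult.commute)
qed

lemma coupling_sum_mono:
  assumes "P \<in> couplings \<mu> \<nu>"
    and "\<And>i j. P $ i $ j > 0 \<Longrightarrow> x i j \<le> (y i j :: real)"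
  shows "(\<Sum>i\<in>UNIV. \<Sum>j\<in>UNIV. P $ i $ j * x i j) \<le> (\<Sum>i\<in>UNIV. \<Sum>j\<in>UNIV. P $ i $ j * y i j)"
proof (intro sum_mono)
  fix i j
  have "0 \<le> P $ i $ j" using assms(1) by (simp add: couplings_def)
  then show "P $ i $ j * x i j \<le> P $ i $ j * y i j"
    using assms(2)[of i j] by (cases "P $ i $ j = 0") (auto intro: mult_left_mono)
qed

lemma coupling_total:
  assumes "P \<in> couplings \<mu> \<nu>" "pos_prob \<mu>"
  shows "(\<Sum>i\<in>UNIV. \<Sum>j\<in>UNIV. P $ i $ j * c) = c"
proof -
  have "(\<Sum>i\<in>UNIV. \<Sum>j\<in>UNIV. P $ i $ j * c) = (\<Sum>i\<in>UNIV. \<mu> $ i) * c"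
    using assms(1) by (simp add: couplings_def flip: sum_distrib_right)
  then show ?thesis using pos_prob_sum[OF assms(2)] by simp
qed

text \<open>
  The plan of the potentials \<open>(f, g)\<close> has entries
  \<open>exp ((- C $ i $ j + f $ i + g $ j) / \<tau>) * \<mu> $ i * \<nu> $ j\<close>, and this is the density of its first
  marginal with respect to \<open>\<mu>\<close>.
\<close>

definition row_mass :: "real ^ 'n::finite ^ 'm::finite \<Rightarrow> real ^ 'n \<Rightarrow> real
    \<Rightarrow> (real ^ 'm) \<times> (real ^ 'n) \<Rightarrow> 'm \<Rightarrow> real" where
  "row_mass C \<nu> \<tau> = (\<lambda>(f, g) i. \<Sum>j\<in>UNIV. exp ((- C $ i $ j + f $ i + g $ j) / \<tau>) * \<nu> $ j)"

lemma row_mass_pos: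
  assumes "pos_prob \<nu>" shows "0 < row_mass C \<nu> \<tau> (f, g) i"
  unfolding row_mass_def using pos_prob_pos[OF assms] by (auto intro!: sum_pos)

lemma f_soft_eq:
  assumes "pos_prob \<nu>" "0 < \<tau>"
  shows "f_soft C \<nu> \<tau> g $ i = f $ i - \<tau> * ln (row_mass C \<nu> \<tau> (f, g) i)"
proof -
  let ?s = "\<Sum>j\<in>UNIV. exp ((- C $ i $ j + g $ j) / \<tau>) * \<nu> $ j"
  have s: "0 < ?s" using pos_prob_pos[OF assms(1)] by (auto intro!: sum_pos)
  have "row_mass C \<nu> \<tau> (f, g) i = exp (f $ i / \<tau>) * ?s"
    unfolding row_mass_def
    by (simp add: sum_distrib_left add_divide_distrib diff_divide_distrib exp_add exp_diff mult_ac)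
  then have "ln (row_mass C \<nu> \<tau> (f, g) i) = f $ i / \<tau> + ln ?s"
    using s by (simp add: ln_mult)
  then show ?thesis
    using assms(2) by (simp add: f_soft_def field_simps)
qed

lemma row_mass_f_soft:
  assumes "pos_prob \<nu>" "0 < \<tau>"
  shows "row_mass C \<nu> \<tau> (f_soft C \<nu> \<tau> g, g) i = 1"
proof -
  let ?f = "f_soft C \<nu> \<tau> g"
  have "\<tau> * ln (row_mass C \<nu> \<tau> (?f, g) i) = 0"
    using f_soft_eq[OF assms, of C g i ?f] by simp
  then show ?thesis
    using assms(2) row_mass_pos[OF assms(1), of C \<tau> ?f g i] by simp
qed

lemma Psi_row_mass:
  "Psi C \<mu> \<nu> \<tau> (f, g) = \<tau> * ((\<Sum>i\<in>UNIV. row_mass C \<nu> \<tau> (f, g) i * \<mu> $ i) - 1) - f \<bullet> \<mu> - g \<bullet> \<nu>"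
  unfolding Psi_def row_mass_def by (simp add: sum_distrib_left sum_distrib_right mult_ac)

lemma Psi_f_soft:
  assumes "pos_prob \<mu>" "pos_prob \<nu>" "0 < \<tau>"
  shows "Psi C \<mu> \<nu> \<tau> (f_soft C \<nu> \<tau> g, g) = - (f_soft C \<nu> \<tau> g \<bullet> \<mu>) - g \<bullet> \<nu>"
  using pos_prob_sum[OF assms(1)] by (simp add: Psi_row_mass row_mass_f_soft[OF assms(2,3)])

text \<open>
  This is \<open>\<tau>\<close> times the relative entropy, generalized to measures of unequal mass, of \<open>\<mu>\<close> with
  respect to the first marginal of the current plan: how much a half step gains is how badly the
  current plan misses the marginal.
\<close>

lemma Psi_drop_f_soft:
  assumes "pos_prob \<mu>" "pos_prob \<nu>" "0 < \<tau>"
  shows "Psi C \<mu> \<nu> \<tau> (f, g) - Psi C \<mu> \<nu> \<tau> (f_soft C \<nu> \<tau> g, g)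
     = \<tau> * (\<Sum>i\<in>UNIV. (row_mass C \<nu> \<tau> (f, g) i - 1 - ln (row_mass C \<nu> \<tau> (f, g) i)) * \<mu> $ i)"
proof -
  let ?a = "row_mass C \<nu> \<tau> (f, g)"
  have "f_soft C \<nu> \<tau> g \<bullet> \<mu> = f \<bullet> \<mu> - \<tau> * (\<Sum>i\<in>UNIV. ln (?a i) * \<mu> $ i)"
    by (simp add: inner_vec_def f_soft_eq[OF assms(2,3), of C g _ f] left_diff_distrib
        sum_subtractf sum_distrib_left mult.assoc)
  moreover have "(\<Sum>i\<in>UNIV. (?a i - 1 - ln (?a i)) * \<mu> $ i)
      = (\<Sum>i\<in>UNIV. ?a i * \<mu> $ i) - 1 - (\<Sum>i\<in>UNIV. ln (?a i) * \<mu> $ i)"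
    using pos_prob_sum[OF assms(1)] by (simp add: left_diff_distrib sum_subtractf)
  ultimately show ?thesis
    unfolding Psi_f_soft[OF assms] Psi_row_mass[of C \<mu> \<nu> \<tau> f g] by (simp add: right_diff_distrib)
qed

lemma sqrt_le_entropy_term:
  assumes "0 < (a::real)" shows "(sqrt a - 1)\<^sup>2 \<le> a - 1 - ln a"
proof -
  have "ln a = 2 * ln (sqrt a)" using assms by (simp add: ln_sqrt)
  also have "\<dots> \<le> 2 * (sqrt a - 1)" using assms by (intro mult_left_mono ln_le_minus_one) auto
  finally show ?thesis using assms by (simp add: power2_diff)
qed

text \<open>
  The squared Hellinger distance replaces the relative entropy because it stays finite and
  continuous when a row mass vanishes, as needed for a compactness argument on the set of all plans.
\<close>

lemma Psi_drop_ge_hellinger: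
  assumes "pos_prob \<mu>" "pos_prob \<nu>" "0 < \<tau>"
  shows "Psi C \<mu> \<nu> \<tau> (f, g) - Psi C \<mu> \<nu> \<tau> (f_soft C \<nu> \<tau> g, g)
     \<ge> \<tau> * (\<Sum>i\<in>UNIV. (sqrt (row_mass C \<nu> \<tau> (f, g) i) - 1)\<^sup>2 * \<mu> $ i)"
  unfolding Psi_drop_f_soft[OF assms]
  using sqrt_le_entropy_term[OF row_mass_pos[OF assms(2)]] pos_prob_pos[OF assms(1)] assms(3)
  by (intro mult_left_mono sum_mono mult_right_mono) (auto intro: less_imp_le)

lemma Psi_f_soft_le:
  assumes "pos_prob \<mu>" "pos_prob \<nu>" "0 < \<tau>"
  shows "Psi C \<mu> \<nu> \<tau> (f_soft C \<nu> \<tau> g, g) \<le> Psi C \<mu> \<nu> \<tau> (f, g)"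
proof -
  have "0 \<le> \<tau> * (\<Sum>i\<in>UNIV. (sqrt (row_mass C \<nu> \<tau> (f, g) i) - 1)\<^sup>2 * \<mu> $ i)"
    using pos_prob_pos[OF assms(1)] assms(3)
    by (intro mult_nonneg_nonneg sum_nonneg) (auto intro: less_imp_le)
  then show ?thesis using Psi_drop_ge_hellinger[OF assms, of C f g] by linarith
qed

lemma f_soft_term_le:
  assumes "pos_prob \<nu>" "0 < \<tau>"
  shows "exp ((- C $ i $ j + f_soft C \<nu> \<tau> g $ i + g $ j) / \<tau>) * \<nu> $ j \<le> 1"
proof -
  have "exp ((- C $ i $ j + f_soft C \<nu> \<tau> g $ i + g $ j) / \<tau>) * \<nu> $ j
      \<le> row_mass C \<nu> \<tau> (f_soft C \<nu> \<tau> g, g) i"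
    unfolding row_mass_def prod.case using pos_prob_pos[OF assms(1)]
    by (intro member_le_sum[where f = "\<lambda>j. exp ((- C $ i $ j + f_soft C \<nu> \<tau> g $ i + g $ j) / \<tau>) * \<nu> $ j"]) (auto simp: less_imp_le)
  then show ?thesis by (simp add: row_mass_f_soft[OF assms])
qed

text \<open>
  The terms of a row mass are nonnegative and add up to 1 after the update, so none exceeds 1: soft
  updates leave the dual polytope by at most \<open>O(\<tau>)\<close>.
\<close>

lemma f_soft_almost_feasible:
  assumes "pos_prob \<nu>" "0 < \<tau>"
  shows "f_soft C \<nu> \<tau> g $ i + g $ j \<le> C $ i $ j + \<tau> * (- ln (\<nu> $ j))"
proof -
  have "ln (exp ((- C $ i $ j + f_soft C \<nu> \<tau> g $ i + g $ j) / \<tau>) * \<nu> $ j) \<le> 0"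
    using f_soft_term_le[OF assms] pos_prob_pos[OF assms(1)] by (subst ln_le_zero_iff) auto
  then have "(- C $ i $ j + f_soft C \<nu> \<tau> g $ i + g $ j) / \<tau> \<le> - ln (\<nu> $ j)"
    using pos_prob_pos[OF assms(1), of j] by (simp add: ln_mult)
  then show ?thesis using assms(2) by (simp add: field_simps)
qed

text \<open>
  After the update, the exponentials in a row have \<open>\<nu>\<close>-average 1, so one of them is at least 1.
\<close>

lemma f_soft_contact:
  assumes "pos_prob \<nu>" "0 < \<tau>"
  obtains j where "C $ i $ j \<le> f_soft C \<nu> \<tau> g $ i + g $ j"
proof (rule ccontr)
  assume "\<not> thesis"
  then have *: "f_soft C \<nu> \<tau> g $ i + g $ j < C $ i $ j" for j using that[of j] by force
  have "row_mass C \<nu> \<tau> (f_soft C \<nu> \<tau> g, g) i < (\<Sum>j\<in>UNIV. \<nu> $ j)"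
    unfolding row_mass_def prod.case
  proof (rule sum_strict_mono)
    fix j :: 'a
    have "exp ((- C $ i $ j + f_soft C \<nu> \<tau> g $ i + g $ j) / \<tau>) < 1"
      using *[of j] assms(2) by (simp add: divide_neg_pos)
    then show "exp ((- C $ i $ j + f_soft C \<nu> \<tau> g $ i + g $ j) / \<tau>) * \<nu> $ j < \<nu> $ j"
      using pos_prob_pos[OF assms(1), of j] by simp
  qed auto
  then show False by (simp add: row_mass_f_soft[OF assms] pos_prob_sum[OF assms(1)])
qed

text \<open>
  Weak duality up to \<open>O(\<tau>)\<close>: a half step only decreases the objective and makes the potentials
  almost feasible, and then they are integrated against the coupling.
\<close>

lemma Psi_ge_coupling:
  assumes "pos_prob \<mu>" "pos_prob \<nu>" "0 < \<tau>" "P \<in> couplings \<mu> \<nu>"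
  shows "Psi C \<mu> \<nu> \<tau> p \<ge> - (\<Sum>i\<in>UNIV. \<Sum>j\<in>UNIV. P $ i $ j * C $ i $ j) - \<tau> * total_surprisal \<nu>"
proof -
  obtain f g where p: "p = (f, g)" by fastforce
  let ?f = "f_soft C \<nu> \<tau> g"
  have "?f \<bullet> \<mu> + g \<bullet> \<nu> = (\<Sum>i\<in>UNIV. \<Sum>j\<in>UNIV. P $ i $ j * (?f $ i + g $ j))"
    using coupling_sum_potentials[OF assms(4)] by simp
  also have "\<dots> \<le> (\<Sum>i\<in>UNIV. \<Sum>j\<in>UNIV. P $ i $ j * (C $ i $ j + \<tau> * total_surprisal \<nu>))"
  proof (rule coupling_sum_mono[OF assms(4)])
    fix i j
    have "\<tau> * (- ln (\<nu> $ j)) \<le> \<tau> * total_surprisal \<nu>"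
      using surprisal_le_total[OF assms(2)] assms(3) by (intro mult_left_mono) auto
    then show "?f $ i + g $ j \<le> C $ i $ j + \<tau> * total_surprisal \<nu>"
      using f_soft_almost_feasible[OF assms(2,3), of C g i j] by linarith
  qed
  also have "\<dots> = (\<Sum>i\<in>UNIV. \<Sum>j\<in>UNIV. P $ i $ j * C $ i $ j) + \<tau> * total_surprisal \<nu>"
    by (simp only: distrib_left sum.distrib coupling_total[OF assms(4,1)])
  finally show ?thesis
    using Psi_f_soft_le[OF assms(1-3), of C g f] by (simp add: p Psi_f_soft[OF assms(1-3)])
qed

section \<open>Exchanging the two marginals\<close>

lemma Psi_transpose: "Psi (transpose C) \<nu> \<mu> \<tau> (g, f) = Psi C \<mu> \<nu> \<tau> (f, g)"
  unfolding Psi_def prod.case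
  by (subst sum.swap) (simp add: transpose_def algebra_simps)

lemma g_soft_transpose: "g_soft C \<mu> \<tau> f = f_soft (transpose C) \<mu> \<tau> f"
  by (simp add: g_soft_def f_soft_def transpose_def)

lemma f_soft_transpose: "f_soft C \<nu> \<tau> g = g_soft (transpose C) \<nu> \<tau> g"
  by (simp add: g_soft_def f_soft_def transpose_def)

lemma Psi_g_soft:
  assumes "pos_prob \<mu>" "pos_prob \<nu>" "0 < \<tau>"
  shows "Psi C \<mu> \<nu> \<tau> (f, g_soft C \<mu> \<tau> f) = - (f \<bullet> \<mu>) - g_soft C \<mu> \<tau> f \<bullet> \<nu>"
  using Psi_f_soft[OF assms(2,1,3), of "transpose C" f] by (simp add: g_soft_transpose Psi_transpose)

lemma col_mass_g_soft:
  assumes "pos_prob \<mu>" "0 < \<tau>"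
  shows "(\<Sum>i\<in>UNIV. exp ((- C $ i $ j + f $ i + g_soft C \<mu> \<tau> f $ j) / \<tau>) * \<mu> $ i) = 1"
  using row_mass_f_soft[OF assms, of "transpose C" f j]
  by (simp add: row_mass_def g_soft_transpose transpose_def algebra_simps)

section \<open>A half step makes progress unless the gap is already small\<close>

definition plans_with_columns :: "real ^ 'n::finite \<Rightarrow> (real ^ 'n ^ 'm::finite) set" where
  "plans_with_columns \<nu> = {\<pi>. (\<forall>i j. 0 \<le> \<pi> $ i $ j) \<and> (\<forall>j. (\<Sum>i\<in>UNIV. \<pi> $ i $ j) = \<nu> $ j)}"

text \<open>
  The squared Hellinger distance of \<open>\<mu>\<close> and the first marginal of \<open>\<pi>\<close>.
\<close>

definition row_defect :: "real ^ 'm::finite \<Rightarrow> real ^ 'n::finite ^ 'm \<Rightarrow> real" where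
  "row_defect \<mu> \<pi> = (\<Sum>i\<in>UNIV. (sqrt ((\<Sum>j\<in>UNIV. \<pi> $ i $ j) / \<mu> $ i) - 1)\<^sup>2 * \<mu> $ i)"

lemma row_defect_nonneg: "pos_prob \<mu> \<Longrightarrow> 0 \<le> row_defect \<mu> \<pi>"
  unfolding row_defect_def
  by (intro sum_nonneg mult_nonneg_nonneg) (auto simp: less_imp_le pos_prob_pos)

lemma row_defect_eq_0:
  assumes "pos_prob \<mu>" "row_defect \<mu> \<pi> = 0"
  shows "(\<Sum>j\<in>UNIV. \<pi> $ i $ j) = \<mu> $ i"
proof -
  have "\<forall>i\<in>UNIV. (sqrt ((\<Sum>j\<in>UNIV. \<pi> $ i $ j) / \<mu> $ i) - 1)\<^sup>2 * \<mu> $ i = 0"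
    using assms(2) unfolding row_defect_def
    by (subst (asm) sum_nonneg_eq_0_iff) (use pos_prob_pos[OF assms(1)] in \<open>auto simp: less_imp_le\<close>)
  then show ?thesis
    using pos_prob_pos[OF assms(1), of i]
    by (metis UNIV_I divide_eq_1_iff less_irrefl mult_eq_0_iff power2_eq_square real_sqrt_eq_1_iff
        right_minus_eq)
qed

lemma continuous_on_row_defect:
  assumes "pos_prob \<mu>" shows "continuous_on S (row_defect \<mu>)"
  unfolding row_defect_def
  by (intro continuous_intros ballI) (metis less_irrefl pos_prob_pos[OF assms])

lemma compact_plans_with_columns:
  fixes \<nu> :: "real ^ 'n::finite"
  shows "compact (plans_with_columns \<nu> :: (real ^ 'n ^ 'm::finite) set)"
proof -
  have "closed (plans_with_columns \<nu> :: (real ^ 'n ^ 'm) set)"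
    unfolding plans_with_columns_def
    by (intro closed_Collect_conj closed_Collect_all closed_Collect_le closed_Collect_eq
        continuous_on_const continuous_on_component continuous_on_sum continuous_on_id)
  moreover have "norm \<pi> \<le> (\<Sum>i\<in>(UNIV::'m set). \<Sum>j\<in>UNIV. \<nu> $ j)"
    if \<pi>: "\<pi> \<in> plans_with_columns \<nu>" for \<pi> :: "real ^ 'n ^ 'm"
  proof -
    have entry: "norm (\<pi> $ i $ j) \<le> \<nu> $ j" for i j
    proof -
      have "\<pi> $ i $ j \<le> (\<Sum>i\<in>UNIV. \<pi> $ i $ j)"
        using \<pi> by (intro member_le_sum[where f = "\<lambda>i. \<pi> $ i $ j"]) (auto simp: plans_with_columns_def)
      then show ?thesis using \<pi> by (simp add: plans_with_columns_def)
    qed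
    have "norm \<pi> \<le> (\<Sum>i\<in>UNIV. norm (\<pi> $ i))" by (simp add: norm_vec_def L2_set_le_sum)
    also have "\<dots> \<le> (\<Sum>i\<in>(UNIV::'m set). \<Sum>j\<in>UNIV. \<nu> $ j)"
    proof (rule sum_mono)
      fix i
      have "norm (\<pi> $ i) \<le> (\<Sum>j\<in>UNIV. norm (\<pi> $ i $ j))" by (simp add: norm_vec_def L2_set_le_sum)
      also have "\<dots> \<le> (\<Sum>j\<in>UNIV. \<nu> $ j)" by (rule sum_mono) (rule entry)
      finally show "norm (\<pi> $ i) \<le> (\<Sum>j\<in>UNIV. \<nu> $ j)" .
    qed
    finally show ?thesis .
  qed
  then have "bounded (plans_with_columns \<nu> :: (real ^ 'n ^ 'm) set)"
    unfolding bounded_iff by blast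
  ultimately show ?thesis by (simp add: compact_eq_bounded_closed)
qed

text \<open>
  The defect plus the mass outside \<open>E\<close> is continuous on a compact set, and it vanishes exactly at the
  couplings of \<open>\<mu>\<close> and \<open>\<nu>\<close> carried by \<open>E\<close>. If there is no such coupling, it has a positive minimum.
\<close>

lemma coupling_on_edges_threshold:
  fixes \<mu> :: "real ^ 'm::finite" and \<nu> :: "real ^ 'n::finite" and E :: "('m \<times> 'n) set"
  assumes "pos_prob \<mu>"
  shows "\<exists>e>0. \<forall>\<pi>\<in>plans_with_columns \<nu>. row_defect \<mu> \<pi> + (\<Sum>(i,j)\<in>-E. \<pi> $ i $ j) < e
     \<longrightarrow> (\<exists>P\<in>couplings \<mu> \<nu>. \<forall>i j. 0 < P $ i $ j \<longrightarrow> (i, j) \<in> E)"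
proof -
  define G :: "real ^ 'n ^ 'm \<Rightarrow> real" where "G \<pi> = row_defect \<mu> \<pi> + (\<Sum>(i,j)\<in>-E. \<pi> $ i $ j)" for \<pi>
  let ?S = "plans_with_columns \<nu> :: (real ^ 'n ^ 'm) set"
  define good where "good \<longleftrightarrow> (\<exists>P\<in>couplings \<mu> \<nu>. \<forall>i j. 0 < P $ i $ j \<longrightarrow> (i, j) \<in> E)"
  have zero: good if S: "\<pi> \<in> ?S" and 0: "G \<pi> \<le> 0" for \<pi>
  proof -
    have pos: "0 \<le> \<pi> $ i $ j" for i j using S by (simp add: plans_with_columns_def)
    have En: "0 \<le> (\<Sum>(i,j)\<in>-E. \<pi> $ i $ j)" using pos by (intro sum_nonneg) auto
    have "row_defect \<mu> \<pi> = 0"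
      using row_defect_nonneg[OF assms, of \<pi>] 0 En unfolding G_def by linarith
    note row = row_defect_eq_0[OF assms this]
    have "(\<Sum>(i,j)\<in>-E. \<pi> $ i $ j) = 0"
      using row_defect_nonneg[OF assms, of \<pi>] 0 En unfolding G_def by linarith
    then have "\<forall>x\<in>-E. (case x of (i,j) \<Rightarrow> \<pi> $ i $ j) = 0"
      by (subst (asm) sum_nonneg_eq_0_iff) (use pos in auto)
    then have "(i, j) \<in> E" if "0 < \<pi> $ i $ j" for i j
      using that by (metis (no_types, lifting) ComplI case_prod_conv less_irrefl)
    then show ?thesis
      using S row unfolding good_def by (intro bexI[of _ \<pi>]) (auto simp: couplings_def plans_with_columns_def)
  qed
  have "\<exists>e>0. \<forall>\<pi>\<in>?S. G \<pi> < e \<longrightarrow> good"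
  proof (cases "?S = {} \<or> good")
    case True
    then show ?thesis by (intro exI[of _ 1] conjI zero_less_one) blast
  next
    case False
    have "continuous_on ?S G"
      unfolding G_def case_prod_beta
      by (intro continuous_on_add continuous_on_row_defect[OF assms] continuous_on_sum continuous_on_component continuous_on_id)
    then obtain \<pi>0 where \<pi>0: "\<pi>0 \<in> ?S" "\<And>\<pi>. \<pi> \<in> ?S \<Longrightarrow> G \<pi>0 \<le> G \<pi>"
      using False continuous_attains_inf[OF compact_plans_with_columns] by metis
    have "0 < G \<pi>0" using zero[OF \<pi>0(1)] False by force
    then show ?thesis
      using \<pi>0 by (intro exI[of _ "G \<pi>0"]) (meson not_less)
  qed
  then show ?thesis unfolding G_def good_def .
qed

text \<open>
  There are finitely many edge sets, so one threshold serves all of them. It is applied to the set of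
  entries that are not tiny: if a plan has the right second and almost the right first marginal,
  then its heavy entries alone carry an exact coupling.
\<close>

lemma coupling_on_heavy_entries:
  fixes \<mu> :: "real ^ 'm::finite" and \<nu> :: "real ^ 'n::finite"
  assumes "pos_prob \<mu>"
  shows "\<exists>c>0. \<exists>\<eta>>0. \<forall>\<pi>\<in>plans_with_columns \<nu>. row_defect \<mu> \<pi> < c
     \<longrightarrow> (\<exists>P\<in>couplings \<mu> \<nu>. \<forall>i j. 0 < P $ i $ j \<longrightarrow> \<eta> \<le> \<pi> $ i $ j)"
proof -
  define Q where "Q E e \<longleftrightarrow> 0 < e \<and> (\<forall>\<pi>\<in>plans_with_columns \<nu>. row_defect \<mu> \<pi> + (\<Sum>(i,j)\<in>-E. \<pi> $ i $ j) < e
     \<longrightarrow> (\<exists>P\<in>couplings \<mu> \<nu>. \<forall>i j. 0 < P $ i $ j \<longrightarrow> (i, j) \<in> E))" for E :: "('m \<times> 'n) set" and e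
  have "\<forall>E. \<exists>e. Q E e"
    unfolding Q_def by (intro allI) (rule coupling_on_edges_threshold[OF assms])
  then obtain e where e: "\<And>E. Q E (e E)" by metis
  define e0 where "e0 = Min (range e)"
  have e0: "0 < e0" "e0 \<le> e E" for E using e by (auto simp: e0_def Q_def)
  define N where "N = real (CARD('m) * CARD('n))"
  have N: "0 < N" by (simp add: N_def)
  have "\<exists>P\<in>couplings \<mu> \<nu>. \<forall>i j. 0 < P $ i $ j \<longrightarrow> e0 / (2 * N) \<le> \<pi> $ i $ j"
    if \<pi>: "\<pi> \<in> plans_with_columns \<nu>" and small: "row_defect \<mu> \<pi> < e0 / 2" for \<pi>
  proof -
    define E where "E = {(i, j). e0 / (2 * N) \<le> \<pi> $ i $ j}"
    have "(\<Sum>(i,j)\<in>-E. \<pi> $ i $ j) \<le> (\<Sum>x\<in>-E. e0 / (2 * N))"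
      by (rule sum_mono) (auto simp: E_def)
    also have "\<dots> \<le> real (CARD('m \<times> 'n)) * (e0 / (2 * N))"
      unfolding sum_constant using e0 N
      by (intro mult_right_mono of_nat_mono card_mono) auto
    also have "\<dots> = e0 / 2" using N by (simp add: N_def)
    finally have "row_defect \<mu> \<pi> + (\<Sum>(i,j)\<in>-E. \<pi> $ i $ j) < e E"
      using small e0(2)[of E] by linarith
    then obtain P where "P \<in> couplings \<mu> \<nu>" "\<forall>i j. 0 < P $ i $ j \<longrightarrow> (i, j) \<in> E"
      using e[of E] \<pi> unfolding Q_def by blast
    then show ?thesis by (intro bexI[of _ P]) (auto simp: E_def)
  qed
  then show ?thesis
    using e0 N by (intro exI[of _ "e0 / 2"] conjI exI[of _ "e0 / (2 * N)"]) auto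
qed

text \<open>
  If the half step gains little, the current plan has
  almost the right first marginal, so some exact coupling lives on its heavy entries. A heavy entry
  means \<open>f $ i + g $ j \<ge> C $ i $ j - O(\<tau>)\<close>, so that the potentials almost satisfy complementary
  slackness with this coupling, and weak duality bounds the gap by \<open>O(\<tau>)\<close>.
\<close>

lemma drop_or_near_optimal_f_step:
  fixes \<mu> :: "real ^ 'm::finite" and \<nu> :: "real ^ 'n::finite"
  assumes "pos_prob \<mu>" "pos_prob \<nu>"
  obtains c B where "0 < c" "0 \<le> B"
    "\<And>(C :: real ^ 'n ^ 'm) \<tau> f g p. 0 < \<tau> \<Longrightarrow> g = g_soft C \<mu> \<tau> f \<Longrightarrow>
       Psi C \<mu> \<nu> \<tau> (f_soft C \<nu> \<tau> g, g) \<le> Psi C \<mu> \<nu> \<tau> (f, g) - c * \<tau>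
       \<or> Psi C \<mu> \<nu> \<tau> (f, g) \<le> Psi C \<mu> \<nu> \<tau> p + B * \<tau>"
proof -
  obtain c \<eta> where c: "0 < c" and \<eta>: "0 < \<eta>" and
    heavy: "\<forall>\<pi>\<in>plans_with_columns \<nu>. row_defect \<mu> \<pi> < c
     \<longrightarrow> (\<exists>P\<in>couplings \<mu> \<nu>. \<forall>i j. 0 < P $ i $ j \<longrightarrow> \<eta> \<le> \<pi> $ i $ j)"
    using coupling_on_heavy_entries[OF assms(1)] by blast
  define B where "B = \<bar>ln \<eta>\<bar> + total_surprisal \<nu>"
  show ?thesis
  proof (rule that[OF c, of B])
    show "0 \<le> B" using total_surprisal_nonneg[OF assms(2)] by (simp add: B_def)
  next
    fix C :: "real ^ 'n ^ 'm" and \<tau> f g p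
    assume \<tau>: "0 < \<tau>" and g: "g = g_soft C \<mu> \<tau> f"
    define \<pi> :: "real ^ 'n ^ 'm" where
      "\<pi> = (\<chi> i j. exp ((- C $ i $ j + f $ i + g $ j) / \<tau>) * \<mu> $ i * \<nu> $ j)"
    let ?a = "row_mass C \<nu> \<tau> (f, g)"
    have pos: "0 \<le> \<pi> $ i $ j" for i j
      using pos_prob_pos[OF assms(1)] pos_prob_pos[OF assms(2)] by (simp add: \<pi>_def less_imp_le)
    have col: "(\<Sum>i\<in>UNIV. \<pi> $ i $ j) = \<nu> $ j" for j
    proof -
      have "(\<Sum>i\<in>UNIV. exp ((- C $ i $ j + f $ i + g $ j) / \<tau>) * \<mu> $ i) = 1"
        unfolding g by (rule col_mass_g_soft[OF assms(1) \<tau>])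
      then show ?thesis by (simp add: \<pi>_def flip: sum_distrib_right)
    qed
    have plan: "\<pi> \<in> plans_with_columns \<nu>" using pos col by (simp add: plans_with_columns_def)
    have row: "(\<Sum>j\<in>UNIV. \<pi> $ i $ j) / \<mu> $ i = ?a i" for i
      using pos_prob_pos[OF assms(1), of i]
      by (simp add: \<pi>_def row_mass_def sum_divide_distrib)
    have defect: "row_defect \<mu> \<pi> = (\<Sum>i\<in>UNIV. (sqrt (?a i) - 1)\<^sup>2 * \<mu> $ i)"
      by (simp add: row_defect_def row)
    show "Psi C \<mu> \<nu> \<tau> (f_soft C \<nu> \<tau> g, g) \<le> Psi C \<mu> \<nu> \<tau> (f, g) - c * \<tau>
       \<or> Psi C \<mu> \<nu> \<tau> (f, g) \<le> Psi C \<mu> \<nu> \<tau> p + B * \<tau>"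
    proof (cases "row_defect \<mu> \<pi> < c")
      case False
      then have "c * \<tau> \<le> \<tau> * (\<Sum>i\<in>UNIV. (sqrt (?a i) - 1)\<^sup>2 * \<mu> $ i)" using \<tau> by (simp add: defect)
      then show ?thesis using Psi_drop_ge_hellinger[OF assms \<tau>, of C f g] by linarith
    next
      case True
      then obtain P where P: "P \<in> couplings \<mu> \<nu>" and supp: "\<And>i j. 0 < P $ i $ j \<Longrightarrow> \<eta> \<le> \<pi> $ i $ j"
        using heavy plan by blast
      have edge: "C $ i $ j + \<tau> * ln \<eta> \<le> f $ i + g $ j" if "0 < P $ i $ j" for i j
      proof -
        have "\<mu> $ i * \<nu> $ j \<le> 1"
          using pos_prob_le_1[OF assms(1), of i] pos_prob_le_1[OF assms(2), of j]
            pos_prob_pos[OF assms(2), of j] by (simp add: mult_le_one)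
        then have "exp ((- C $ i $ j + f $ i + g $ j) / \<tau>) * (\<mu> $ i * \<nu> $ j)
            \<le> exp ((- C $ i $ j + f $ i + g $ j) / \<tau>) * 1"
          by (rule mult_left_mono) auto
        moreover have "\<eta> \<le> exp ((- C $ i $ j + f $ i + g $ j) / \<tau>) * (\<mu> $ i * \<nu> $ j)"
          using supp[OF that] unfolding \<pi>_def by (simp add: mult.assoc)
        ultimately have "\<eta> \<le> exp ((- C $ i $ j + f $ i + g $ j) / \<tau>)" by linarith
        then have "ln \<eta> \<le> (- C $ i $ j + f $ i + g $ j) / \<tau>"
          using \<eta> by (metis ln_exp ln_le_cancel_iff exp_gt_zero)
        then show ?thesis using \<tau> by (simp add: field_simps)
      qed
      have "(\<Sum>i\<in>UNIV. \<Sum>j\<in>UNIV. P $ i $ j * C $ i $ j) + \<tau> * ln \<eta>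
          = (\<Sum>i\<in>UNIV. \<Sum>j\<in>UNIV. P $ i $ j * (C $ i $ j + \<tau> * ln \<eta>))"
        by (simp only: distrib_left sum.distrib coupling_total[OF P assms(1)])
      also have "\<dots> \<le> (\<Sum>i\<in>UNIV. \<Sum>j\<in>UNIV. P $ i $ j * (f $ i + g $ j))"
        by (rule coupling_sum_mono[OF P edge])
      also have "\<dots> = f \<bullet> \<mu> + g \<bullet> \<nu>" by (rule coupling_sum_potentials[OF P])
      finally have 1: "(\<Sum>i\<in>UNIV. \<Sum>j\<in>UNIV. P $ i $ j * C $ i $ j) + \<tau> * ln \<eta> \<le> f \<bullet> \<mu> + g \<bullet> \<nu>" .
      have 2: "Psi C \<mu> \<nu> \<tau> (f, g) = - (f \<bullet> \<mu>) - g \<bullet> \<nu>"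
        unfolding g by (rule Psi_g_soft[OF assms \<tau>])
      have 3: "\<tau> * (- ln \<eta>) \<le> \<tau> * \<bar>ln \<eta>\<bar>" using \<tau> by (intro mult_left_mono) auto
      have "Psi C \<mu> \<nu> \<tau> (f, g) \<le> Psi C \<mu> \<nu> \<tau> p + B * \<tau>"
        using 1 2 3 Psi_ge_coupling[OF assms \<tau> P, of C p] by (simp add: B_def algebra_simps)
      then show ?thesis ..
    qed
  qed
qed

text \<open>
  Both half steps, with common constants: the second half step is the first one for the transposed
  cost.
\<close>

lemma drop_or_near_optimal:
  fixes \<mu> :: "real ^ 'm::finite" and \<nu> :: "real ^ 'n::finite"
  assumes \<mu>: "pos_prob \<mu>" and \<nu>: "pos_prob \<nu>"
  obtains c B where "0 < c" "0 \<le> B"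
    "\<And>(C :: real ^ 'n ^ 'm) (\<tau> :: real) f g p. 0 < \<tau> \<Longrightarrow> g = g_soft C \<mu> \<tau> f \<Longrightarrow>
       Psi C \<mu> \<nu> \<tau> (f_soft C \<nu> \<tau> g, g) \<le> Psi C \<mu> \<nu> \<tau> (f, g) - c * \<tau>
       \<or> Psi C \<mu> \<nu> \<tau> (f, g) \<le> Psi C \<mu> \<nu> \<tau> p + B * \<tau>"
    "\<And>(C :: real ^ 'n ^ 'm) (\<tau> :: real) f g p. 0 < \<tau> \<Longrightarrow> f = f_soft C \<nu> \<tau> g \<Longrightarrow>
       Psi C \<mu> \<nu> \<tau> (f, g_soft C \<mu> \<tau> f) \<le> Psi C \<mu> \<nu> \<tau> (f, g) - c * \<tau>
       \<or> Psi C \<mu> \<nu> \<tau> (f, g) \<le> Psi C \<mu> \<nu> \<tau> p + B * \<tau>"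
proof -
  obtain c1 B1 where 1: "0 < c1" "0 \<le> B1"
    "\<And>(C :: real ^ 'n ^ 'm) (\<tau> :: real) f g p. 0 < \<tau> \<Longrightarrow> g = g_soft C \<mu> \<tau> f \<Longrightarrow>
       Psi C \<mu> \<nu> \<tau> (f_soft C \<nu> \<tau> g, g) \<le> Psi C \<mu> \<nu> \<tau> (f, g) - c1 * \<tau>
       \<or> Psi C \<mu> \<nu> \<tau> (f, g) \<le> Psi C \<mu> \<nu> \<tau> p + B1 * \<tau>"
    using drop_or_near_optimal_f_step[OF \<mu> \<nu>] by blast
  obtain c2 B2 where 2: "0 < c2" "0 \<le> B2"
    "\<And>(C :: real ^ 'm ^ 'n) (\<tau> :: real) f g p. 0 < \<tau> \<Longrightarrow> g = g_soft C \<nu> \<tau> f \<Longrightarrow>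
       Psi C \<nu> \<mu> \<tau> (f_soft C \<mu> \<tau> g, g) \<le> Psi C \<nu> \<mu> \<tau> (f, g) - c2 * \<tau>
       \<or> Psi C \<nu> \<mu> \<tau> (f, g) \<le> Psi C \<nu> \<mu> \<tau> p + B2 * \<tau>"
    using drop_or_near_optimal_f_step[OF \<nu> \<mu>] by blast
  have le: "min c1 c2 * \<tau> \<le> c1 * \<tau>" "min c1 c2 * \<tau> \<le> c2 * \<tau>"
      "B1 * \<tau> \<le> max B1 B2 * \<tau>" "B2 * \<tau> \<le> max B1 B2 * \<tau>" if "0 < \<tau>" for \<tau> :: real
    using that by (auto intro!: mult_right_mono)
  show ?thesis
  proof (rule that[of "min c1 c2" "max B1 B2"])
    fix C :: "real ^ 'n ^ 'm" and \<tau> :: real and f g p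
    assume \<tau>: "0 < \<tau>"
    show "Psi C \<mu> \<nu> \<tau> (f_soft C \<nu> \<tau> g, g) \<le> Psi C \<mu> \<nu> \<tau> (f, g) - min c1 c2 * \<tau>
       \<or> Psi C \<mu> \<nu> \<tau> (f, g) \<le> Psi C \<mu> \<nu> \<tau> p + max B1 B2 * \<tau>" if "g = g_soft C \<mu> \<tau> f"
      using 1(3)[OF \<tau> that, of p] le[OF \<tau>] by linarith
    show "Psi C \<mu> \<nu> \<tau> (f, g_soft C \<mu> \<tau> f) \<le> Psi C \<mu> \<nu> \<tau> (f, g) - min c1 c2 * \<tau>
       \<or> Psi C \<mu> \<nu> \<tau> (f, g) \<le> Psi C \<mu> \<nu> \<tau> p + max B1 B2 * \<tau>" if "f = f_soft C \<nu> \<tau> g"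
    proof -
      obtain p1 p2 where p: "p = (p1, p2)" by fastforce
      show ?thesis
        using 2(3)[OF \<tau>, of f "transpose C" g "(p2, p1)"] that le[OF \<tau>]
        unfolding p Psi_transpose g_soft_transpose[symmetric] f_soft_transpose[symmetric] by linarith
    qed
  qed (use 1(1,2) 2(1,2) in auto)
qed

section \<open>Upper bound on the progress of a half step\<close>

text \<open>
  If \<open>f\<close> comes from a previous update, then no entry of the plan of \<open>(f, g0)\<close> exceeds \<open>1 / \<nu> $ j\<close>
  relative to \<open>\<mu> $ i * \<nu> $ j\<close>, so the update of \<open>g0\<close> lowers no coordinate by more than \<open>O(\<tau>)\<close>.
  The row masses, which were 1 before this update, therefore stay bounded away from 0, and the next
  update of \<open>f\<close> raises no coordinate by more than \<open>O(\<tau>)\<close>.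
\<close>

lemma Psi_drop_le_f_step:
  assumes \<mu>: "pos_prob \<mu>" and \<nu>: "pos_prob \<nu>" and \<tau>: "0 < \<tau>"
    and f: "f = f_soft C \<nu> \<tau> g0" and g: "g = g_soft C \<mu> \<tau> f"
  shows "Psi C \<mu> \<nu> \<tau> (f, g) - Psi C \<mu> \<nu> \<tau> (f_soft C \<nu> \<tau> g, g) \<le> total_surprisal \<nu> * \<tau>"
proof -
  note [simp] = pos_prob_pos[OF \<nu>] pos_prob_pos[OF \<mu>]
  define K where "K i j h = exp ((- C $ i $ j + f $ i + h) / \<tau>)" for i j h
  have shift: "K i j (h + d) = K i j h * exp (d / \<tau>)" for i j h d
    by (simp add: K_def add_divide_distrib exp_add)
  have g_ge: "g0 $ j + \<tau> * ln (\<nu> $ j) \<le> g $ j" for j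
  proof -
    have "K i j (g0 $ j) * \<nu> $ j \<le> 1" for i
      using f_soft_term_le[OF \<nu> \<tau>, of C i j g0] by (simp add: K_def f)
    then have "K i j (g0 $ j + \<tau> * ln (\<nu> $ j)) \<le> 1" for i
      using \<tau> by (simp add: shift)
    then have "(\<Sum>i\<in>UNIV. K i j (g0 $ j + \<tau> * ln (\<nu> $ j)) * \<mu> $ i) \<le> 1"
      by (rule pos_prob_avg_le[OF \<mu>])
    then have "(\<Sum>i\<in>UNIV. K i j (g0 $ j + \<tau> * ln (\<nu> $ j)) * \<mu> $ i) * exp (d / \<tau>) \<le> 1 * exp (d / \<tau>)" for d
      by (rule mult_right_mono) simp
    moreover define d where "d = g $ j - (g0 $ j + \<tau> * ln (\<nu> $ j))"
    then have "(\<Sum>i\<in>UNIV. K i j (g $ j) * \<mu> $ i)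
        = (\<Sum>i\<in>UNIV. K i j (g0 $ j + \<tau> * ln (\<nu> $ j)) * \<mu> $ i) * exp (d / \<tau>)"
      using shift[of _ j "g0 $ j + \<tau> * ln (\<nu> $ j)" d] by (simp add: sum_distrib_right sum_distrib_left d_def mult_ac)
    moreover have "(\<Sum>i\<in>UNIV. K i j (g $ j) * \<mu> $ i) = 1"
      unfolding g K_def by (rule col_mass_g_soft[OF \<mu> \<tau>])
    ultimately have "1 \<le> 1 * exp (d / \<tau>)" by metis
    then show ?thesis using \<tau> by (simp add: d_def zero_le_divide_iff)
  qed
  have incr: "f_soft C \<nu> \<tau> g $ i - f $ i \<le> total_surprisal \<nu> * \<tau>" for i
  proof -
    have "exp (- total_surprisal \<nu>) = (\<Sum>j\<in>UNIV. K i j (g0 $ j) * \<nu> $ j) * exp (- total_surprisal \<nu>)"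
      using row_mass_f_soft[OF \<nu> \<tau>, of C g0 i] by (simp add: row_mass_def f K_def)
    also have "\<dots> = (\<Sum>j\<in>UNIV. K i j (g0 $ j + \<tau> * (- total_surprisal \<nu>)) * \<nu> $ j)"
      using shift[of i _ _ "\<tau> * (- total_surprisal \<nu>)"] \<tau> by (simp add: sum_distrib_left mult_ac)
    also have "\<dots> \<le> (\<Sum>j\<in>UNIV. K i j (g $ j) * \<nu> $ j)"
    proof (intro sum_mono mult_right_mono)
      fix j
      have "\<tau> * (- total_surprisal \<nu>) \<le> \<tau> * ln (\<nu> $ j)"
        using surprisal_le_total[OF \<nu>, of j] \<tau> by (intro mult_left_mono) auto
      then have "g0 $ j + \<tau> * (- total_surprisal \<nu>) \<le> g $ j" using g_ge[of j] by linarith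
      then show "K i j (g0 $ j + \<tau> * (- total_surprisal \<nu>)) \<le> K i j (g $ j)"
        using \<tau> unfolding K_def by (intro exp_le_cancel_iff[THEN iffD2] divide_right_mono) auto
    qed (simp add: less_imp_le)
    also have "\<dots> = row_mass C \<nu> \<tau> (f, g) i" by (simp add: row_mass_def K_def)
    finally have "- total_surprisal \<nu> \<le> ln (row_mass C \<nu> \<tau> (f, g) i)"
      by (simp add: ln_ge_iff row_mass_pos[OF \<nu>])
    then have "\<tau> * - total_surprisal \<nu> \<le> \<tau> * ln (row_mass C \<nu> \<tau> (f, g) i)"
      using \<tau> by (intro mult_left_mono) auto
    then show ?thesis by (simp add: f_soft_eq[OF \<nu> \<tau>, of C g i f] mult.commute)
  qed
  have "Psi C \<mu> \<nu> \<tau> (f, g) = - (f \<bullet> \<mu>) - g \<bullet> \<nu>"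
    unfolding g by (rule Psi_g_soft[OF \<mu> \<nu> \<tau>])
  then have "Psi C \<mu> \<nu> \<tau> (f, g) - Psi C \<mu> \<nu> \<tau> (f_soft C \<nu> \<tau> g, g)
      = (\<Sum>i\<in>UNIV. (f_soft C \<nu> \<tau> g $ i - f $ i) * \<mu> $ i)"
    by (simp add: Psi_f_soft[OF \<mu> \<nu> \<tau>] inner_vec_def left_diff_distrib sum_subtractf)
  also have "\<dots> \<le> total_surprisal \<nu> * \<tau>" by (rule pos_prob_avg_le[OF \<mu> incr])
  finally show ?thesis .
qed

lemma Psi_drop_le_g_step:
  assumes \<mu>: "pos_prob \<mu>" and \<nu>: "pos_prob \<nu>" and \<tau>: "0 < \<tau>"
    and g: "g = g_soft C \<mu> \<tau> f0" and f: "f = f_soft C \<nu> \<tau> g"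
  shows "Psi C \<mu> \<nu> \<tau> (f, g) - Psi C \<mu> \<nu> \<tau> (f, g_soft C \<mu> \<tau> f) \<le> total_surprisal \<mu> * \<tau>"
  using Psi_drop_le_f_step[OF \<nu> \<mu> \<tau> g[unfolded g_soft_transpose] f[unfolded f_soft_transpose]]
  by (simp add: Psi_transpose flip: g_soft_transpose)

lemma Psi_g_soft_le:
  assumes \<mu>: "pos_prob \<mu>" and \<nu>: "pos_prob \<nu>" and \<tau>: "0 < \<tau>"
  shows "Psi C \<mu> \<nu> \<tau> (f, g_soft C \<mu> \<tau> f) \<le> Psi C \<mu> \<nu> \<tau> (f, g)"
  using Psi_f_soft_le[OF \<nu> \<mu> \<tau>, of "transpose C" f g] by (simp add: Psi_transpose g_soft_transpose)

section \<open>Iterates of the algorithm\<close>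

text \<open>
  From the second iterate on, both potentials are outputs of soft updates, as the upper bound on the
  progress of a half step requires.
\<close>

lemma sinkhorn_shape:
  assumes "sinkhorn C \<mu> \<nu> \<tau> p (k + 2) = (f, g)"
  shows "even k \<Longrightarrow> (\<exists>h. f = f_soft C \<nu> \<tau> h) \<and> g = g_soft C \<mu> \<tau> f
           \<and> sinkhorn C \<mu> \<nu> \<tau> p (k + 3) = (f_soft C \<nu> \<tau> g, g)"
    and "odd k \<Longrightarrow> (\<exists>h. g = g_soft C \<mu> \<tau> h) \<and> f = f_soft C \<nu> \<tau> g
           \<and> sinkhorn C \<mu> \<nu> \<tau> p (k + 3) = (f, g_soft C \<mu> \<tau> f)"
proof -
  obtain a b where ab: "sinkhorn C \<mu> \<nu> \<tau> p k = (a, b)" by fastforce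
  have k3: "k + 3 = Suc (Suc (Suc k))" and k2: "k + 2 = Suc (Suc k)" by auto
  note * = assms[unfolded k2]
  show "even k \<Longrightarrow> (\<exists>h. f = f_soft C \<nu> \<tau> h) \<and> g = g_soft C \<mu> \<tau> f
           \<and> sinkhorn C \<mu> \<nu> \<tau> p (k + 3) = (f_soft C \<nu> \<tau> g, g)"
    using * unfolding k3 by (auto simp: Let_def ab)
  show "odd k \<Longrightarrow> (\<exists>h. g = g_soft C \<mu> \<tau> h) \<and> f = f_soft C \<nu> \<tau> g
           \<and> sinkhorn C \<mu> \<nu> \<tau> p (k + 3) = (f, g_soft C \<mu> \<tau> f)"
    using * unfolding k3 by (auto simp: Let_def ab)
qed

lemma sinkhorn_Psi_mono:
  assumes \<mu>: "pos_prob \<mu>" and \<nu>: "pos_prob \<nu>" and \<tau>: "0 < \<tau>"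
  shows "k \<le> l \<Longrightarrow> Psi C \<mu> \<nu> \<tau> (sinkhorn C \<mu> \<nu> \<tau> p l) \<le> Psi C \<mu> \<nu> \<tau> (sinkhorn C \<mu> \<nu> \<tau> p k)"
proof (induction rule: dec_induct)
  case (step n)
  obtain f g where "sinkhorn C \<mu> \<nu> \<tau> p n = (f, g)" by fastforce
  then show ?case
    using step.IH Psi_f_soft_le[OF \<mu> \<nu> \<tau>, of C g f] Psi_g_soft_le[OF \<mu> \<nu> \<tau>, of C f g]
    by (auto simp: Let_def)
qed simp

lemma sinkhorn_Psi_drop_le:
  assumes \<mu>: "pos_prob \<mu>" and \<nu>: "pos_prob \<nu>" and \<tau>: "0 < \<tau>"
  shows "Psi C \<mu> \<nu> \<tau> (sinkhorn C \<mu> \<nu> \<tau> p (k + 2)) - Psi C \<mu> \<nu> \<tau> (sinkhorn C \<mu> \<nu> \<tau> p (k + 3))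
    \<le> (total_surprisal \<mu> + total_surprisal \<nu>) * \<tau>"
proof -
  obtain f g where fg: "sinkhorn C \<mu> \<nu> \<tau> p (k + 2) = (f, g)" by fastforce
  note shape = sinkhorn_shape[OF fg]
  have "0 \<le> total_surprisal \<mu> * \<tau>" "0 \<le> total_surprisal \<nu> * \<tau>"
    using total_surprisal_nonneg[OF \<mu>] total_surprisal_nonneg[OF \<nu>] \<tau> by auto
  then show ?thesis
  proof (cases "even k")
    case True
    then obtain h where h: "f = f_soft C \<nu> \<tau> h" and s: "g = g_soft C \<mu> \<tau> f"
      "sinkhorn C \<mu> \<nu> \<tau> p (k + 3) = (f_soft C \<nu> \<tau> g, g)" using shape(1) by blast
    show ?thesis
      using Psi_drop_le_f_step[OF \<mu> \<nu> \<tau> h s(1)] \<open>0 \<le> total_surprisal \<mu> * \<tau>\<close> unfolding fg s(2) distrib_right by linarith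
  next
    case False
    then obtain h where h: "g = g_soft C \<mu> \<tau> h" and s: "f = f_soft C \<nu> \<tau> g"
      "sinkhorn C \<mu> \<nu> \<tau> p (k + 3) = (f, g_soft C \<mu> \<tau> f)" using shape(2) by blast
    show ?thesis
      using Psi_drop_le_g_step[OF \<mu> \<nu> \<tau> h s(1)] \<open>0 \<le> total_surprisal \<nu> * \<tau>\<close> unfolding fg s(2) distrib_right by linarith
  qed
qed

lemma sinkhorn_2:
  "sinkhorn C \<mu> \<nu> \<tau> (f0, g0) 2 = (f_soft C \<nu> \<tau> g0, g_soft C \<mu> \<tau> (f_soft C \<nu> \<tau> g0))"
  by (simp add: numeral_2_eq_2)

definition cost_bound :: "real ^ 'n::finite ^ 'm::finite \<Rightarrow> real" where
  "cost_bound C = (\<Sum>i\<in>UNIV. \<Sum>j\<in>UNIV. \<bar>C $ i $ j\<bar>)"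

lemma cost_bound: "\<bar>C $ i $ j\<bar> \<le> cost_bound C"
proof -
  have "\<bar>C $ i $ j\<bar> \<le> (\<Sum>j\<in>UNIV. \<bar>C $ i $ j\<bar>)" by (rule member_le_sum) auto
  also have "\<dots> \<le> cost_bound C"
    unfolding cost_bound_def
    by (rule member_le_sum[where f = "\<lambda>i. \<Sum>j\<in>UNIV. \<bar>C $ i $ j\<bar>"]) (auto intro: sum_nonneg)
  finally show ?thesis .
qed

text \<open>
  The oscillation of a soft update is controlled by the cost alone, whatever \<open>g\<close> is. This makes the
  value after two steps bounded uniformly in the initialization.
\<close>

lemma f_soft_oscillation:
  assumes \<nu>: "pos_prob \<nu>" and \<tau>: "0 < \<tau>"
  shows "f_soft C \<nu> \<tau> g $ i \<le> f_soft C \<nu> \<tau> g $ k + 2 * cost_bound C"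
proof -
  let ?f = "f_soft C \<nu> \<tau> g"
  \<comment> \<open>If coordinate \<open>i\<close> is raised this far, row \<open>i\<close> dominates row \<open>k\<close>, which has mass 1.\<close>
  define h where "h = (\<chi> l. if l = i then ?f $ k + 2 * cost_bound C else ?f $ l)"
  note [simp] = pos_prob_pos[OF \<nu>]
  have "1 = row_mass C \<nu> \<tau> (?f, g) k" by (simp add: row_mass_f_soft[OF \<nu> \<tau>])
  also have "\<dots> \<le> row_mass C \<nu> \<tau> (h, g) i"
    unfolding row_mass_def prod.case
  proof (intro sum_mono mult_right_mono)
    fix j
    have "- C $ k $ j + ?f $ k + g $ j \<le> - C $ i $ j + h $ i + g $ j"
      using cost_bound[of C i j] cost_bound[of C k j] by (simp add: h_def)
    then show "exp ((- C $ k $ j + ?f $ k + g $ j) / \<tau>) \<le> exp ((- C $ i $ j + h $ i + g $ j) / \<tau>)"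
      using \<tau> by (intro exp_le_cancel_iff[THEN iffD2] divide_right_mono) auto
  qed (simp add: less_imp_le)
  finally have "0 \<le> ln (row_mass C \<nu> \<tau> (h, g) i)" by (simp add: ln_ge_iff row_mass_pos[OF \<nu>])
  then show ?thesis
    using f_soft_eq[OF \<nu> \<tau>, of C g i h] \<tau> by (simp add: h_def)
qed

lemma Psi_sinkhorn_2_le:
  assumes \<mu>: "pos_prob \<mu>" and \<nu>: "pos_prob \<nu>" and \<tau>: "0 < \<tau>"
  shows "Psi C \<mu> \<nu> \<tau> (sinkhorn C \<mu> \<nu> \<tau> (f0, g0) 2) \<le> 3 * cost_bound C"
proof -
  define f where "f = f_soft C \<nu> \<tau> g0"
  define g where "g = g_soft C \<mu> \<tau> f"
  have ge: "- (3 * cost_bound C) \<le> f $ i + g $ j" for i j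
  proof -
    obtain k where "C $ k $ j \<le> f $ k + g $ j"
      using f_soft_contact[OF \<mu> \<tau>, of "transpose C" j f]
      by (auto simp: g_def g_soft_transpose transpose_def add.commute)
    moreover have "f $ k \<le> f $ i + 2 * cost_bound C"
      using f_soft_oscillation[OF \<nu> \<tau>] by (simp add: f_def)
    ultimately show ?thesis using cost_bound[of C k j] by linarith
  qed
  let ?P = "(\<chi> i j. \<mu> $ i * \<nu> $ j) :: real ^ 'b ^ 'a"
  note P = product_coupling[OF \<mu> \<nu>]
  have "- (3 * cost_bound C) = (\<Sum>i\<in>UNIV. \<Sum>j\<in>UNIV. ?P $ i $ j * (- (3 * cost_bound C)))"
    by (rule coupling_total[OF P \<mu>, symmetric])
  also have "\<dots> \<le> (\<Sum>i\<in>UNIV. \<Sum>j\<in>UNIV. ?P $ i $ j * (f $ i + g $ j))"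
    by (rule coupling_sum_mono[OF P ge])
  also have "\<dots> = f \<bullet> \<mu> + g \<bullet> \<nu>" by (rule coupling_sum_potentials[OF P])
  finally have "- (f \<bullet> \<mu>) - g \<bullet> \<nu> \<le> 3 * cost_bound C" by simp
  moreover have "Psi C \<mu> \<nu> \<tau> (f, g) = - (f \<bullet> \<mu>) - g \<bullet> \<nu>"
    unfolding g_def by (rule Psi_g_soft[OF \<mu> \<nu> \<tau>])
  ultimately show ?thesis by (simp add: sinkhorn_2 f_def g_def)
qed

lemma Psi_bounded_below:
  assumes \<mu>: "pos_prob \<mu>" and \<nu>: "pos_prob \<nu>" and \<tau>: "0 < \<tau>"
  shows "- cost_bound C - \<tau> * total_surprisal \<nu> \<le> Psi C \<mu> \<nu> \<tau> p"
proof -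
  let ?P = "(\<chi> i j. \<mu> $ i * \<nu> $ j) :: real ^ 'b ^ 'a"
  note P = product_coupling[OF \<mu> \<nu>]
  have "C $ i $ j \<le> cost_bound C" for i j using cost_bound[of C i j] by simp
  then have "(\<Sum>i\<in>UNIV. \<Sum>j\<in>UNIV. ?P $ i $ j * C $ i $ j) \<le> (\<Sum>i\<in>UNIV. \<Sum>j\<in>UNIV. ?P $ i $ j * cost_bound C)"
    by (rule coupling_sum_mono[OF P])
  also have "\<dots> = cost_bound C" by (rule coupling_total[OF P \<mu>])
  finally show ?thesis using Psi_ge_coupling[OF \<mu> \<nu> \<tau> P, of C p] by linarith
qed

text \<open>
  On the polytope all exponents are nonpositive, so the plan has mass at most 1.
\<close>

lemma Psi_le_Psi0:
  assumes \<mu>: "pos_prob \<mu>" and \<nu>: "pos_prob \<nu>" and \<tau>: "0 < \<tau>" and p: "p \<in> dual_polytope C"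
  shows "Psi C \<mu> \<nu> \<tau> p \<le> Psi0 \<mu> \<nu> p"
proof -
  obtain f g where fg: "p = (f, g)" by fastforce
  have "row_mass C \<nu> \<tau> (f, g) i \<le> 1" for i
    unfolding row_mass_def prod.case
  proof (rule pos_prob_avg_le[OF \<nu>])
    fix j
    have "f $ i + g $ j \<le> C $ i $ j" using p by (simp add: fg dual_polytope_def)
    then show "exp ((- C $ i $ j + f $ i + g $ j) / \<tau>) \<le> 1"
      using \<tau> by (simp add: divide_nonpos_pos)
  qed
  then have "(\<Sum>i\<in>UNIV. row_mass C \<nu> \<tau> (f, g) i * \<mu> $ i) \<le> 1" by (rule pos_prob_avg_le[OF \<mu>])
  then have "\<tau> * ((\<Sum>i\<in>UNIV. row_mass C \<nu> \<tau> (f, g) i * \<mu> $ i) - 1) \<le> 0"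
    using \<tau> by (simp add: mult_nonneg_nonpos)
  then show ?thesis by (simp add: fg Psi_row_mass Psi0_def)
qed

lemma f_soft_near_f_hard:
  assumes \<nu>: "pos_prob \<nu>" and \<tau>: "0 < \<tau>"
  shows "f_hard C g $ i \<le> f_soft C \<nu> \<tau> g $ i"
    and "f_soft C \<nu> \<tau> g $ i \<le> f_hard C g $ i + \<tau> * total_surprisal \<nu>"
proof -
  obtain j where "C $ i $ j \<le> f_soft C \<nu> \<tau> g $ i + g $ j" using f_soft_contact[OF \<nu> \<tau>] .
  moreover have "f_hard C g $ i \<le> C $ i $ j - g $ j" by (simp add: f_hard_def)
  ultimately show "f_hard C g $ i \<le> f_soft C \<nu> \<tau> g $ i" by linarith
  obtain j where "f_hard C g $ i = C $ i $ j - g $ j"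
    using MIN_attained[of "\<lambda>j. C $ i $ j - g $ j"] that by (auto simp: f_hard_def)
  moreover have "\<tau> * (- ln (\<nu> $ j)) \<le> \<tau> * total_surprisal \<nu>"
    using surprisal_le_total[OF \<nu>] \<tau> by (intro mult_left_mono) auto
  ultimately show "f_soft C \<nu> \<tau> g $ i \<le> f_hard C g $ i + \<tau> * total_surprisal \<nu>"
    using f_soft_almost_feasible[OF \<nu> \<tau>, of C g i j] by linarith
qed

lemma g_hard_transpose: "g_hard C f = f_hard (transpose C) f"
  by (simp add: g_hard_def f_hard_def transpose_def)

lemma g_hard_antimono:
  assumes "\<And>i. f $ i \<le> h $ i" shows "g_hard C h $ j \<le> g_hard C f $ j"
proof -
  obtain i where "g_hard C f $ j = C $ i $ j - f $ i"
    using MIN_attained[of "\<lambda>i. C $ i $ j - f $ i"] that by (auto simp: g_hard_def)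
  moreover have "g_hard C h $ j \<le> C $ i $ j - h $ i" by (simp add: g_hard_def)
  ultimately show ?thesis using assms[of i] by linarith
qed

text \<open>
  Two soft updates stay within \<open>O(\<tau>)\<close>, from above, of the corresponding two hard updates.
\<close>

lemma Psi_sinkhorn_2_ge:
  assumes \<mu>: "pos_prob \<mu>" and \<nu>: "pos_prob \<nu>" and \<tau>: "0 < \<tau>"
  shows "Psi0 \<mu> \<nu> (cold_init C g0) - (total_surprisal \<mu> + total_surprisal \<nu>) * \<tau>
     \<le> Psi C \<mu> \<nu> \<tau> (sinkhorn C \<mu> \<nu> \<tau> (f0, g0) 2)"
proof -
  define f where "f = f_soft C \<nu> \<tau> g0"
  define g where "g = g_soft C \<mu> \<tau> f"
  have f: "f $ i - f_hard C g0 $ i \<le> \<tau> * total_surprisal \<nu>" for i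
    using f_soft_near_f_hard(2)[OF \<nu> \<tau>, of C g0 i] by (simp add: f_def)
  have g: "g $ j - g_hard C (f_hard C g0) $ j \<le> \<tau> * total_surprisal \<mu>" for j
  proof -
    have "g $ j \<le> g_hard C f $ j + \<tau> * total_surprisal \<mu>"
      using f_soft_near_f_hard(2)[OF \<mu> \<tau>, of "transpose C" f j]
      by (simp add: g_def g_soft_transpose g_hard_transpose)
    moreover have "g_hard C f $ j \<le> g_hard C (f_hard C g0) $ j"
      by (rule g_hard_antimono) (simp add: f_def f_soft_near_f_hard(1)[OF \<nu> \<tau>])
    ultimately show ?thesis by linarith
  qed
  have "f \<bullet> \<mu> - f_hard C g0 \<bullet> \<mu> \<le> \<tau> * total_surprisal \<nu>"
    using pos_prob_avg_le[OF \<mu> f] by (simp add: inner_vec_def left_diff_distrib sum_subtractf)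
  moreover have "g \<bullet> \<nu> - g_hard C (f_hard C g0) \<bullet> \<nu> \<le> \<tau> * total_surprisal \<mu>"
    using pos_prob_avg_le[OF \<nu> g] by (simp add: inner_vec_def left_diff_distrib sum_subtractf)
  moreover have "Psi C \<mu> \<nu> \<tau> (f, g) = - (f \<bullet> \<mu>) - g \<bullet> \<nu>"
    unfolding g_def by (rule Psi_g_soft[OF \<mu> \<nu> \<tau>])
  ultimately show ?thesis
    by (simp add: sinkhorn_2 f_def g_def cold_init_def Psi0_def algebra_simps)
qed

section \<open>The gap after order 1 / tau steps\<close>

text \<open>
  Values of the objective range over a bounded interval from the second iterate on, and each step
  outside the \<open>O(\<tau>)\<close> neighbourhood of the minimum lowers the value by \<open>c * \<tau>\<close>; so there are at most
  \<open>O(1 / \<tau>)\<close> such steps.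
\<close>

lemma sinkhorn_gap_le:
  fixes \<mu> :: "real ^ 'm::finite" and \<nu> :: "real ^ 'n::finite" and C :: "real ^ 'n ^ 'm"
  assumes \<mu>: "pos_prob \<mu>" and \<nu>: "pos_prob \<nu>"
  obtains T B where "0 \<le> B" "\<And>\<tau> p k. 0 < \<tau> \<Longrightarrow> \<tau> \<le> 1 \<Longrightarrow> T / \<tau> \<le> real k \<Longrightarrow>
     Psi C \<mu> \<nu> \<tau> (sinkhorn C \<mu> \<nu> \<tau> p k) - (INF q. Psi C \<mu> \<nu> \<tau> q) \<le> B * \<tau>"
proof -
  obtain c B where c: "0 < c" and B: "0 \<le> B" and
    even: "\<And>(C :: real ^ 'n ^ 'm) \<tau> f g p. 0 < \<tau> \<Longrightarrow> g = g_soft C \<mu> \<tau> f \<Longrightarrow>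
       Psi C \<mu> \<nu> \<tau> (f_soft C \<nu> \<tau> g, g) \<le> Psi C \<mu> \<nu> \<tau> (f, g) - c * \<tau>
       \<or> Psi C \<mu> \<nu> \<tau> (f, g) \<le> Psi C \<mu> \<nu> \<tau> p + B * \<tau>" and
    odd: "\<And>(C :: real ^ 'n ^ 'm) \<tau> f g p. 0 < \<tau> \<Longrightarrow> f = f_soft C \<nu> \<tau> g \<Longrightarrow>
       Psi C \<mu> \<nu> \<tau> (f, g_soft C \<mu> \<tau> f) \<le> Psi C \<mu> \<nu> \<tau> (f, g) - c * \<tau>
       \<or> Psi C \<mu> \<nu> \<tau> (f, g) \<le> Psi C \<mu> \<nu> \<tau> p + B * \<tau>"
    using drop_or_near_optimal[OF \<mu> \<nu>] by blast
  define M where "M = 4 * cost_bound C + total_surprisal \<nu>"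
  have M: "0 \<le> M" using total_surprisal_nonneg[OF \<nu>] cost_bound[of C undefined undefined] by (simp add: M_def)
  show ?thesis
  \<comment> \<open>The slack 3 pays for the first two steps and for a strict inequality.\<close>
  proof (rule that[OF B, of "M / c + 3"])
    fix \<tau> :: real and p :: "(real ^ 'm) \<times> (real ^ 'n)" and k :: nat
    assume \<tau>: "0 < \<tau>" "\<tau> \<le> 1" and k: "(M / c + 3) / \<tau> \<le> real k"
    define \<Phi> where "\<Phi> l = Psi C \<mu> \<nu> \<tau> (sinkhorn C \<mu> \<nu> \<tau> p (l + 2))" for l
    have \<Phi>_mono: "\<Phi> l \<le> \<Phi> i" if "i \<le> l" for i l
      unfolding \<Phi>_def by (rule sinkhorn_Psi_mono[OF \<mu> \<nu> \<tau>(1)]) (use that in simp)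
    have step: "\<Phi> (Suc l) \<le> \<Phi> l - c * \<tau> \<or> \<Phi> l \<le> Psi C \<mu> \<nu> \<tau> q + B * \<tau>" for l q
    proof -
      obtain f g where fg: "sinkhorn C \<mu> \<nu> \<tau> p (l + 2) = (f, g)" by fastforce
      have Suc: "Suc l + 2 = l + 3" by simp
      show ?thesis
        using sinkhorn_shape[OF fg] even[OF \<tau>(1), of g C f q] odd[OF \<tau>(1), of f C g q]
        unfolding \<Phi>_def Suc fg by (cases "even l") (auto simp del: sinkhorn.simps)
    qed
    have "3 / \<tau> \<le> (M / c + 3) / \<tau>" using \<tau> M c by (intro divide_right_mono) auto
    moreover have "3 \<le> 3 / \<tau>" using \<tau> by (simp add: le_divide_eq)
    ultimately have "3 \<le> real k" using k by linarith
    then have "2 \<le> k" by linarith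
    then obtain n where n: "k = n + 2" by (metis add.commute le_Suc_ex)
    have "M / c + 3 \<le> real k * \<tau>" using k \<tau> by (simp add: pos_divide_le_eq)
    then have "M / c < real n * \<tau>" using \<tau> by (simp add: n distrib_right)
    then have nM: "M < real n * (c * \<tau>)" using c by (simp add: pos_divide_less_eq mult_ac)
    have "\<Phi> n - B * \<tau> \<le> Psi C \<mu> \<nu> \<tau> q" for q
    proof (rule ccontr)
      assume far: "\<not> \<Phi> n - B * \<tau> \<le> Psi C \<mu> \<nu> \<tau> q"
      have "\<Phi> l \<le> \<Phi> 0 - real l * (c * \<tau>)" if "l \<le> n" for l
        using that
      proof (induction l)
        case (Suc l)
        then show ?case using step[of l q] \<Phi>_mono[of l n] far by (auto simp: algebra_simps)
      qed simp
      then have "\<Phi> n < \<Phi> 0 - M" using nM by (meson diff_strict_left_mono order_le_less_trans order_refl)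
      moreover have "\<Phi> 0 \<le> 3 * cost_bound C"
        using Psi_sinkhorn_2_le[OF \<mu> \<nu> \<tau>(1), of C "fst p" "snd p"] by (simp add: \<Phi>_def numeral_2_eq_2 del: sinkhorn.simps)
      moreover have "\<tau> * total_surprisal \<nu> \<le> total_surprisal \<nu>"
        using \<tau> total_surprisal_nonneg[OF \<nu>] by (simp add: mult_left_le_one_le)
      then have "- cost_bound C - total_surprisal \<nu> \<le> \<Phi> n"
        using Psi_bounded_below[OF \<mu> \<nu> \<tau>(1), of C "sinkhorn C \<mu> \<nu> \<tau> p (n + 2)"] unfolding \<Phi>_def by linarith
      ultimately show False by (simp add: M_def)
    qed
    then have "\<Phi> n - B * \<tau> \<le> (INF q. Psi C \<mu> \<nu> \<tau> q)" by (intro cINF_greatest) auto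
    then show "Psi C \<mu> \<nu> \<tau> (sinkhorn C \<mu> \<nu> \<tau> p k) - (INF q. Psi C \<mu> \<nu> \<tau> q) \<le> B * \<tau>"
      by (simp add: \<Phi>_def n del: sinkhorn.simps)
  qed
qed

text \<open>
  The second iterate starts near the value of \<open>Psi0\<close> at the cold initialization, the minimum is at
  most \<open>Psi0 \<mu> \<nu> q\<close>, and each step gains at most \<open>D * \<tau>\<close>. The constant \<open>T\<close> is chosen so that
  \<open>T / \<tau>\<close> steps use up only half of the initial gap.
\<close>

lemma sinkhorn_gap_ge:
  fixes \<mu> :: "real ^ 'm::finite" and \<nu> :: "real ^ 'n::finite" and C :: "real ^ 'n ^ 'm"
  assumes \<mu>: "pos_prob \<mu>" and \<nu>: "pos_prob \<nu>"
    and q: "q \<in> dual_polytope C" "Psi0 \<mu> \<nu> q < Psi0 \<mu> \<nu> (cold_init C g0)"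
  obtains T B D where "0 < T" "0 < B" "0 < D" "\<And>\<tau> k. 0 < \<tau> \<Longrightarrow> real k \<le> T / \<tau> \<Longrightarrow>
     B - D * \<tau> \<le> Psi C \<mu> \<nu> \<tau> (sinkhorn C \<mu> \<nu> \<tau> (f0, g0) k) - (INF p. Psi C \<mu> \<nu> \<tau> p)"
proof -
  define \<delta> where "\<delta> = Psi0 \<mu> \<nu> (cold_init C g0) - Psi0 \<mu> \<nu> q"
  \<comment> \<open>The summand 1 keeps \<open>D\<close> positive when both marginals are point masses.\<close>
  define D where "D = total_surprisal \<mu> + total_surprisal \<nu> + 1"
  have D: "0 < D" using total_surprisal_nonneg[OF \<mu>] total_surprisal_nonneg[OF \<nu>] by (simp add: D_def)
  have \<delta>: "0 < \<delta>" using q by (simp add: \<delta>_def)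
  show ?thesis
  proof (rule that[of "\<delta> / (2 * D)" "\<delta> / 2" D])
    fix \<tau> :: real and k :: nat
    assume \<tau>: "0 < \<tau>" and k: "real k \<le> \<delta> / (2 * D) / \<tau>"
    define \<Phi> where "\<Phi> l = Psi C \<mu> \<nu> \<tau> (sinkhorn C \<mu> \<nu> \<tau> (f0, g0) l)" for l
    have D_ge: "(total_surprisal \<mu> + total_surprisal \<nu>) * \<tau> \<le> D * \<tau>"
      using \<tau> by (intro mult_right_mono) (auto simp: D_def)
    have start: "Psi0 \<mu> \<nu> (cold_init C g0) - D * \<tau> \<le> \<Phi> 2"
      using Psi_sinkhorn_2_ge[OF \<mu> \<nu> \<tau>, of C g0 f0] D_ge unfolding \<Phi>_def by linarith
    have decr: "\<Phi> 2 - real l * (D * \<tau>) \<le> \<Phi> (l + 2)" for l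
    proof (induction l)
      case (Suc l)
      have "Suc l + 2 = l + 3" by simp
      then have "\<Phi> (l + 2) - \<Phi> (Suc l + 2) \<le> D * \<tau>"
        using sinkhorn_Psi_drop_le[OF \<mu> \<nu> \<tau>, of C "(f0, g0)" l] D_ge unfolding \<Phi>_def by (metis order_trans)
      then show ?case using Suc by (simp add: algebra_simps)
    qed (simp add: numeral_2_eq_2)
    have "\<Phi> (k + 2) \<le> \<Phi> k" unfolding \<Phi>_def by (rule sinkhorn_Psi_mono[OF \<mu> \<nu> \<tau>]) simp
    moreover have "real k * (D * \<tau>) \<le> \<delta> / 2" using k D \<tau> by (simp add: field_simps)
    ultimately have "Psi0 \<mu> \<nu> (cold_init C g0) - D * \<tau> - \<delta> / 2 \<le> \<Phi> k"
      using start decr[of k] by linarith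
    moreover have "(INF p. Psi C \<mu> \<nu> \<tau> p) \<le> Psi C \<mu> \<nu> \<tau> q"
      using Psi_bounded_below[OF \<mu> \<nu> \<tau>] by (intro cINF_lower bdd_belowI2) auto
    moreover have "Psi C \<mu> \<nu> \<tau> q \<le> Psi0 \<mu> \<nu> q" by (rule Psi_le_Psi0[OF \<mu> \<nu> \<tau> q(1)])
    ultimately have "\<delta> / 2 - D * \<tau> \<le> \<Phi> k - (INF p. Psi C \<mu> \<nu> \<tau> p)"
      using \<delta>_def by linarith
    then show "\<delta> / 2 - D * \<tau> \<le> Psi C \<mu> \<nu> \<tau> (sinkhorn C \<mu> \<nu> \<tau> (f0, g0) k) - (INF p. Psi C \<mu> \<nu> \<tau> p)"
      by (simp only: \<Phi>_def)
  qed (use D \<delta> in auto)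
qed

section \<open>Projections in relative entropy\<close>

lemma continuous_on_x_ln_x:
  assumes "0 < (q::real)"
  shows "continuous_on {0..} (\<lambda>x. x * ln (x / q))"
proof (unfold continuous_on_eq_continuous_within, rule ballI)
  fix x :: real assume x: "x \<in> {0..}"
  show "continuous (at x within {0..}) (\<lambda>x. x * ln (x / q))"
  proof (cases "x = 0")
    case True
    have "((\<lambda>x. x * ln (x / q)) \<longlongrightarrow> 0) (at_right 0)" using assms by real_asymp
    moreover have "at 0 within {0::real..} = at_right 0"
      by (rule at_within_nhd[of _ UNIV]) auto
    ultimately show ?thesis by (simp add: True continuous_within)
  next
    case False
    then show ?thesis using x assms by (intro continuous_intros) auto
  qed
qed

lemma continuous_on_rel_entropy:
  assumes "pos_prob q" shows "continuous_on prob_simplex (\<lambda>x. rel_entropy x q)"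
  unfolding rel_entropy_def
proof (intro continuous_on_sum)
  fix i
  have "continuous_on prob_simplex ((\<lambda>x. x * ln (x / q $ i)) \<circ> (\<lambda>x. x $ i))"
    by (intro continuous_on_compose continuous_on_component continuous_on_id
        continuous_on_subset[OF continuous_on_x_ln_x[OF pos_prob_pos[OF assms]]])
      (auto simp: prob_simplex_def)
  then show "continuous_on prob_simplex (\<lambda>x. x $ i * ln (x $ i / q $ i))" by (simp add: o_def)
qed

text \<open>
  This is \<open>ln u \<le> u - 1\<close> at \<open>u = y / x\<close>, with its equality case.
\<close>

lemma x_ln_x_tangent:
  assumes "0 \<le> (x::real)" "0 < y"
  shows "x - y \<le> x * ln (x / y)" and "x * ln (x / y) = x - y \<Longrightarrow> x = y"
proof -
  have *: "x - y \<le> x * ln (x / y) \<and> (x * ln (x / y) = x - y \<longrightarrow> x = y)"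
  proof (cases "x = 0")
    case False
    then have x: "0 < x" using assms by simp
    have eq: "ln (x / y) = - ln (y / x)" using x assms by (simp add: ln_div)
    have "x * ln (y / x) \<le> x * (y / x - 1)"
      using x assms by (intro mult_left_mono ln_le_minus_one) auto
    moreover have "x * (y / x - 1) = y - x" using x by (simp add: field_simps)
    moreover have "x = y" if "x * ln (y / x) = y - x"
    proof -
      have "ln (y / x) = y / x - 1" using that x by (simp add: field_simps)
      then have "y / x = 1" using x assms by (intro ln_eq_minus_one) auto
      then show ?thesis using x by simp
    qed
    ultimately show ?thesis unfolding eq by auto
  qed (use assms in auto)
  show "x - y \<le> x * ln (x / y)" and "x * ln (x / y) = x - y \<Longrightarrow> x = y" using * by auto
qed

lemma rel_entropy_nonneg:
  assumes "x \<in> prob_simplex" "pos_prob y"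
  shows "0 \<le> rel_entropy x y" and "rel_entropy x y = 0 \<Longrightarrow> x = y"
proof -
  have x: "0 \<le> x $ i" for i using assms(1) by (simp add: prob_simplex_def)
  note t = x_ln_x_tangent[OF x pos_prob_pos[OF assms(2)]]
  have eq: "rel_entropy x y = (\<Sum>i\<in>UNIV. x $ i * ln (x $ i / y $ i) - (x $ i - y $ i))"
    using pos_prob_sum[OF assms(2)] assms(1) by (simp add: rel_entropy_def sum_subtractf prob_simplex_def)
  show "0 \<le> rel_entropy x y" unfolding eq using t(1) by (intro sum_nonneg) auto
  show "x = y" if "rel_entropy x y = 0"
  proof -
    have "\<forall>i\<in>UNIV. x $ i * ln (x $ i / y $ i) - (x $ i - y $ i) = 0"
      using that t(1) unfolding eq by (subst (asm) sum_nonneg_eq_0_iff) auto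
    then have "x $ i = y $ i" for i using t(2)[of i i] by auto
    then show ?thesis by (simp add: vec_eq_iff)
  qed
qed

text \<open>
  For a minimizer \<open>y\<close> the last sum is nonpositive, and the identity then gives the Pythagorean
  inequality, hence also uniqueness of the minimizer.
\<close>

lemma rel_entropy_pythagoras:
  assumes "x \<in> prob_simplex" "pos_prob y" "pos_prob q"
  shows "rel_entropy x q = rel_entropy y q + rel_entropy x y - (\<Sum>i\<in>UNIV. (x $ i - y $ i) * ln (q $ i / y $ i))"
proof -
  have "x $ i * ln (x $ i / q $ i) = y $ i * ln (y $ i / q $ i) + x $ i * ln (x $ i / y $ i)
      - (x $ i - y $ i) * ln (q $ i / y $ i)" for i
  proof -
    have "x $ i * ln (x $ i / q $ i) = x $ i * ln (x $ i / y $ i) - x $ i * ln (q $ i / y $ i)"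
      using pos_prob_pos[OF assms(2), of i] pos_prob_pos[OF assms(3), of i] assms(1)
      by (cases "x $ i = 0") (auto simp: prob_simplex_def ln_div algebra_simps order_le_less)
    moreover have "ln (y $ i / q $ i) = - ln (q $ i / y $ i)"
      using pos_prob_pos[OF assms(2), of i] pos_prob_pos[OF assms(3), of i] by (simp add: ln_div)
    ultimately show ?thesis by (simp add: algebra_simps)
  qed
  then show ?thesis unfolding rel_entropy_def by (simp add: sum.distrib sum_subtractf)
qed

lemma pos_prob_segment:
  assumes "x \<in> prob_simplex" "y \<in> prob_simplex" "\<And>i. 0 < (1 - s) * x $ i + s * y $ i"
  shows "pos_prob ((1 - s) *\<^sub>R x + s *\<^sub>R y)"
proof -
  have "(\<Sum>i\<in>UNIV. ((1 - s) *\<^sub>R x + s *\<^sub>R y) $ i) = 1"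
    using assms(1,2) by (simp add: sum.distrib prob_simplex_def flip: sum_distrib_left)
  then show ?thesis
    using assms(3) unfolding pos_prob_def prob_simplex_def by (auto simp: less_imp_le)
qed

text \<open>
  The variational inequality evaluated at an interior point \<open>z\<close> of the segment instead of the
  endpoint \<open>x\<close>, where the logarithms could be infinite.
\<close>

lemma rel_entropy_segment:
  assumes "pos_prob q" "x \<in> prob_simplex" "pos_prob z" "0 < s"
    and z: "z = (1 - s) *\<^sub>R x + s *\<^sub>R y"
    and le: "rel_entropy x q \<le> rel_entropy z q"
  shows "(\<Sum>i\<in>UNIV. (y $ i - x $ i) * ln (q $ i / z $ i)) \<le> 0"
proof -
  have "(\<Sum>i\<in>UNIV. (x $ i - z $ i) * ln (q $ i / z $ i)) \<ge> 0"
    using rel_entropy_pythagoras[OF assms(2,3,1)] rel_entropy_nonneg(1)[OF assms(2,3)] le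
    by linarith
  moreover have "x $ i - z $ i = - (s * (y $ i - x $ i))" for i by (simp add: z algebra_simps)
  ultimately have "s * (\<Sum>i\<in>UNIV. (y $ i - x $ i) * ln (q $ i / z $ i)) \<le> 0"
    by (simp add: sum_negf sum_distrib_left mult.assoc)
  then show ?thesis using assms(4) by (simp add: mult_le_0_iff)
qed

text \<open>
  The slope of the entropy towards a positive point is \<open>-\<infinity>\<close> at the boundary of the simplex: along
  the segment from \<open>x\<close> to \<open>y\<close>, terms with \<open>x $ i = 0\<close> in the variational inequality tend to
  \<open>\<infinity>\<close>, and all other terms converge.
\<close>

lemma entropy_projection_pos:
  assumes "pos_prob q" "x \<in> prob_simplex" "pos_prob y"
    and min: "\<And>s. 0 < s \<Longrightarrow> s \<le> 1 \<Longrightarrow> rel_entropy x q \<le> rel_entropy ((1 - s) *\<^sub>R x + s *\<^sub>R y) q"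
  shows "pos_prob x"
proof (rule ccontr)
  assume "\<not> pos_prob x"
  have x0: "0 \<le> x $ i" for i using assms(2) by (simp add: prob_simplex_def)
  obtain k where k: "x $ k = 0"
    using \<open>\<not> pos_prob x\<close> assms(2) x0 by (auto simp: pos_prob_def order_le_less)
  define z where "z s i = (1 - s) * x $ i + s * y $ i" for s i
  define h where "h i s = (y $ i - x $ i) * ln (q $ i / z s i)" for i s
  note [simp] = pos_prob_pos[OF assms(1)] pos_prob_pos[OF assms(3)]
  have top: "filterlim (h i) at_top (at_right 0)" if "x $ i = 0" for i
  proof -
    have "filterlim (\<lambda>s. a * ln (b / (s * a))) at_top (at_right 0)" if "0 < a" "0 < b" for a b :: real
      using that by real_asymp
    from this[of "y $ i" "q $ i"] show ?thesis unfolding h_def z_def that by simp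
  qed
  have fin: "(h i \<longlongrightarrow> (y $ i - x $ i) * ln (q $ i / x $ i)) (at_right 0)" if "x $ i \<noteq> 0" for i
  proof -
    have "((\<lambda>s. z s i) \<longlongrightarrow> z 0 i) (at_right 0)" unfolding z_def by (intro tendsto_intros)
    then have "((\<lambda>s. z s i) \<longlongrightarrow> x $ i) (at_right 0)" by (simp add: z_def)
    moreover have "0 < q $ i / x $ i" using that x0[of i] by (simp add: order_le_less)
    ultimately show ?thesis unfolding h_def by (intro tendsto_intros) (use that in auto)
  qed
  have low: "\<exists>b. \<forall>\<^sub>F s in at_right 0. b \<le> h i s" for i
  proof (cases "x $ i = 0")
    case True
    then show ?thesis using top[OF True] by (auto simp: filterlim_at_top)
  next
    case False
    have "\<forall>\<^sub>F s in at_right 0. (y $ i - x $ i) * ln (q $ i / x $ i) - 1 < h i s"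
      by (rule order_tendstoD(1)[OF fin[OF False]]) simp
    then have "\<forall>\<^sub>F s in at_right 0. (y $ i - x $ i) * ln (q $ i / x $ i) - 1 \<le> h i s"
      by (rule eventually_mono) simp
    then show ?thesis by (rule exI)
  qed
  then obtain b where b: "\<And>i. \<forall>\<^sub>F s in at_right 0. b i \<le> h i s" by metis
  have "\<forall>\<^sub>F s in at_right 0. \<forall>i\<in>UNIV. b i \<le> h i s"
    by (rule eventually_ball_finite) (use b in auto)
  moreover have "\<forall>\<^sub>F s in at_right 0. 1 - (\<Sum>i\<in>UNIV-{k}. b i) \<le> h k s"
    using top[OF k] by (auto simp: filterlim_at_top)
  moreover have "\<forall>\<^sub>F s in at_right (0::real). 0 < s \<and> s \<le> 1"
    by (auto simp: eventually_at_right_field intro!: exI[of _ 1])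
  ultimately have "\<forall>\<^sub>F s in at_right (0::real). False"
  proof eventually_elim
    case (elim s)
    have "(\<Sum>i\<in>UNIV. h i s) = h k s + (\<Sum>i\<in>UNIV-{k}. h i s)" by (subst sum.remove[of _ k]) auto
    moreover have "(\<Sum>i\<in>UNIV-{k}. b i) \<le> (\<Sum>i\<in>UNIV-{k}. h i s)"
      using elim by (intro sum_mono) auto
    moreover have "0 < (1 - s) * x $ i + s * y $ i" for i
      using x0[of i] elim by (intro add_nonneg_pos mult_nonneg_nonneg mult_pos_pos) auto
    then have "pos_prob ((1 - s) *\<^sub>R x + s *\<^sub>R y)"
      using assms(2,3) by (intro pos_prob_segment) (auto simp: pos_prob_def)
    then have "(\<Sum>i\<in>UNIV. h i s) \<le> 0"
      using rel_entropy_segment[OF assms(1,2) _ _ refl min] elim by (simp add: h_def z_def)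
    ultimately show False using elim by linarith
  qed
  then show False by simp
qed

text \<open>
  The limit \<open>s \<rightarrow> 0\<close> of the inequality on the segment, which exists because \<open>x\<close> is positive.
\<close>

lemma entropy_projection_variational:
  assumes "pos_prob q" "pos_prob x" "y \<in> prob_simplex"
    and min: "\<And>s. 0 < s \<Longrightarrow> s \<le> 1 \<Longrightarrow> rel_entropy x q \<le> rel_entropy ((1 - s) *\<^sub>R x + s *\<^sub>R y) q"
  shows "(\<Sum>i\<in>UNIV. (y $ i - x $ i) * ln (q $ i / x $ i)) \<le> 0"
proof (rule tendsto_upperbound)
  have x: "x \<in> prob_simplex" using assms(2) by (simp add: pos_prob_def)
  note [simp] = pos_prob_pos[OF assms(1)] pos_prob_pos[OF assms(2)]
  define h where "h s = (\<Sum>i\<in>UNIV. (y $ i - x $ i) * ln (q $ i / ((1 - s) * x $ i + s * y $ i)))" for s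
  have "(h \<longlongrightarrow> (\<Sum>i\<in>UNIV. (y $ i - x $ i) * ln (q $ i / ((1 - 0) * x $ i + 0 * y $ i)))) (at_right 0)"
    unfolding h_def by (intro tendsto_intros) (auto simp: less_imp_neq[symmetric])
  then show "(h \<longlongrightarrow> (\<Sum>i\<in>UNIV. (y $ i - x $ i) * ln (q $ i / x $ i))) (at_right 0)" by simp
  have "\<forall>\<^sub>F s in at_right (0::real). 0 < s \<and> s < 1"
    by (auto simp: eventually_at_right_field intro!: exI[of _ 1])
  then show "\<forall>\<^sub>F s in at_right 0. h s \<le> 0"
  proof eventually_elim
    case (elim s)
    have "0 < (1 - s) * x $ i + s * y $ i" for i
      using assms(3) elim
      by (intro add_pos_nonneg mult_nonneg_nonneg mult_pos_pos) (auto simp: prob_simplex_def)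
    then have "pos_prob ((1 - s) *\<^sub>R x + s *\<^sub>R y)" by (rule pos_prob_segment[OF x assms(3)])
    then show ?case
      using rel_entropy_segment[OF assms(1) x _ _ refl min] elim by (simp add: h_def)
  qed
qed auto

section \<open>Velocities of the cold dynamics\<close>

definition row_sums :: "real ^ 'n::finite ^ 'm::finite \<Rightarrow> real ^ 'm" where
  "row_sums Q = (\<chi> i. \<Sum>j\<in>UNIV. Q $ i $ j)"

definition col_sums :: "real ^ 'n::finite ^ 'm::finite \<Rightarrow> real ^ 'n" where
  "col_sums Q = (\<chi> j. \<Sum>i\<in>UNIV. Q $ i $ j)"

definition plans_on :: "('m::finite \<times> 'n::finite) set \<Rightarrow> (real ^ 'n ^ 'm) set" where
  "plans_on E = {Q. (\<forall>i j. 0 \<le> Q $ i $ j) \<and> (\<forall>i j. (i, j) \<notin> E \<longrightarrow> Q $ i $ j = 0)}"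

definition no_isolated :: "('m \<times> 'n) set \<Rightarrow> bool" where
  "no_isolated E \<longleftrightarrow> (\<forall>i. \<exists>j. (i, j) \<in> E) \<and> (\<forall>j. \<exists>i. (i, j) \<in> E)"

lemma plans_onD:
  assumes "Q \<in> plans_on E"
  shows "0 \<le> Q $ i $ j" and "0 < Q $ i $ j \<Longrightarrow> (i, j) \<in> E"
  using assms by (auto simp: plans_on_def) (metis less_irrefl)

lemma marginal_X_row_sums:
  assumes "Q \<in> plans_on E" shows "marginal_X E Q = row_sums Q"
proof -
  have "(\<Sum>j\<in>{j. (i, j) \<in> E}. Q $ i $ j) = (\<Sum>j\<in>UNIV. Q $ i $ j)" for i
    by (rule sum.mono_neutral_left) (use assms in \<open>auto simp: plans_on_def\<close>)
  then show ?thesis by (simp add: marginal_X_def row_sums_def)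
qed

lemma marginal_Y_col_sums:
  assumes "Q \<in> plans_on E" shows "marginal_Y E Q = col_sums Q"
proof -
  have "(\<Sum>i\<in>{i. (i, j) \<in> E}. Q $ i $ j) = (\<Sum>i\<in>UNIV. Q $ i $ j)" for j
    by (rule sum.mono_neutral_left) (use assms in \<open>auto simp: plans_on_def\<close>)
  then show ?thesis by (simp add: marginal_Y_def col_sums_def)
qed

lemma total_mass:
  shows "(\<Sum>i\<in>UNIV. row_sums Q $ i) = (\<Sum>(i, j)\<in>UNIV. Q $ i $ j)"
    and "(\<Sum>j\<in>UNIV. col_sums Q $ j) = (\<Sum>(i, j)\<in>UNIV. Q $ i $ j)"
proof -
  show "(\<Sum>i\<in>UNIV. row_sums Q $ i) = (\<Sum>(i, j)\<in>UNIV. Q $ i $ j)"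
    by (simp add: row_sums_def sum.cartesian_product)
  then show "(\<Sum>j\<in>UNIV. col_sums Q $ j) = (\<Sum>(i, j)\<in>UNIV. Q $ i $ j)"
    by (subst (asm) eq_commute) (simp add: row_sums_def col_sums_def, rule sum.swap)
qed

lemma dists_on_iff:
  "Q \<in> dists_on E \<longleftrightarrow> Q \<in> plans_on E \<and> (\<Sum>(i, j)\<in>UNIV. Q $ i $ j) = 1"
proof -
  have "(\<Sum>(i, j)\<in>E. Q $ i $ j) = (\<Sum>(i, j)\<in>UNIV. Q $ i $ j)" if "Q \<in> plans_on E"
    by (rule sum.mono_neutral_left) (use that in \<open>auto simp: plans_on_def\<close>)
  then show ?thesis unfolding dists_on_def plans_on_def by auto
qed

lemma mu_star_eq:
  assumes "pos_prob \<nu>"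
  shows "mu_star \<mu> \<nu> E = arg_min_on (\<lambda>x. rel_entropy x \<mu>) (row_sums ` {Q \<in> plans_on E. col_sums Q = \<nu>})"
proof -
  have "Q \<in> dists_on E \<and> marginal_X E Q = x \<and> marginal_Y E Q = \<nu>
      \<longleftrightarrow> Q \<in> plans_on E \<and> row_sums Q = x \<and> col_sums Q = \<nu>" for Q x
    using pos_prob_sum[OF assms] total_mass(2)[of Q]
    by (auto simp: dists_on_iff marginal_X_row_sums marginal_Y_col_sums)
  then have "{x. \<exists>Q\<in>dists_on E. marginal_X E Q = x \<and> marginal_Y E Q = \<nu>}
      = row_sums ` {Q \<in> plans_on E. col_sums Q = \<nu>}"
    unfolding Bex_def by blast
  then show ?thesis by (simp add: mu_star_def)
qed

lemma nu_star_eq: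
  assumes "pos_prob \<mu>"
  shows "nu_star \<mu> \<nu> E = arg_min_on (\<lambda>y. rel_entropy y \<nu>) (col_sums ` {Q \<in> plans_on E. row_sums Q = \<mu>})"
proof -
  have "P \<in> dists_on E \<and> marginal_X E P = \<mu> \<and> marginal_Y E P = y
      \<longleftrightarrow> P \<in> plans_on E \<and> row_sums P = \<mu> \<and> col_sums P = y" for P y
    using pos_prob_sum[OF assms] total_mass(1)[of P]
    by (auto simp: dists_on_iff marginal_X_row_sums marginal_Y_col_sums)
  then have "{y. \<exists>P\<in>dists_on E. marginal_X E P = \<mu> \<and> marginal_Y E P = y}
      = col_sums ` {Q \<in> plans_on E. row_sums Q = \<mu>}"
    unfolding Bex_def by blast
  then show ?thesis by (simp add: nu_star_def)
qed

lemma row_sums_prob: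
  assumes "Q \<in> plans_on E" "pos_prob (col_sums Q)" shows "row_sums Q \<in> prob_simplex"
  using plans_onD(1)[OF assms(1)] pos_prob_sum[OF assms(2)] total_mass[of Q]
  by (auto simp: prob_simplex_def row_sums_def intro!: sum_nonneg)

lemma col_sums_prob:
  assumes "Q \<in> plans_on E" "pos_prob (row_sums Q)" shows "col_sums Q \<in> prob_simplex"
  using plans_onD(1)[OF assms(1)] pos_prob_sum[OF assms(2)] total_mass[of Q]
  by (auto simp: prob_simplex_def col_sums_def intro!: sum_nonneg)

lemma row_sums_pos_entry:
  assumes "Q \<in> plans_on E" "0 < row_sums Q $ i"
  obtains j where "0 < Q $ i $ j"
proof -
  have "\<exists>j. Q $ i $ j \<noteq> 0"
    using assms(2) by (auto simp: row_sums_def intro: ccontr)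
  then show ?thesis using that plans_onD(1)[OF assms(1)] by (auto simp: order_le_less)
qed

lemma col_sums_pos_entry:
  assumes "Q \<in> plans_on E" "0 < col_sums Q $ j"
  obtains i where "0 < Q $ i $ j"
proof -
  have "\<exists>i. Q $ i $ j \<noteq> 0"
    using assms(2) by (auto simp: col_sums_def intro: ccontr)
  then show ?thesis using that plans_onD(1)[OF assms(1)] by (auto simp: order_le_less)
qed

lemma arg_min_onI:
  assumes "x \<in> S" "\<forall>y\<in>S. f x \<le> (f y :: real)"
  shows "arg_min_on f S \<in> S" and "y \<in> S \<Longrightarrow> f (arg_min_on f S) \<le> f y"
proof -
  have "is_arg_min f (\<lambda>x. x \<in> S) x" using assms by (force simp: is_arg_min_def)
  then have *: "is_arg_min f (\<lambda>x. x \<in> S) (arg_min_on f S)"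
    unfolding arg_min_on_def arg_min_def by (rule someI)
  then show "arg_min_on f S \<in> S" by (simp add: is_arg_min_def)
  show "f (arg_min_on f S) \<le> f y" if "y \<in> S" using * that by (force simp: is_arg_min_def not_less)
qed

lemma full_plan_exists:
  assumes "no_isolated E" "pos_prob \<nu>"
  obtains Q where "Q \<in> plans_on E" "col_sums Q = \<nu>" "pos_prob (row_sums Q)"
proof -
  \<comment> \<open>Spread the mass of each column evenly over its edges.\<close>
  define d where "d j = real (card {i. (i, j) \<in> E})" for j
  define Q where "Q = (\<chi> i j. if (i, j) \<in> E then \<nu> $ j / d j else 0)"
  have d: "0 < d j" for j
    using assms(1) unfolding d_def no_isolated_def by (simp add: card_gt_0_iff)
  note [simp] = pos_prob_pos[OF assms(2)]
  have Q: "Q \<in> plans_on E" by (auto simp: plans_on_def Q_def less_imp_le d)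
  moreover have col: "col_sums Q = \<nu>"
  proof -
    have "(\<Sum>i\<in>UNIV. Q $ i $ j) = \<nu> $ j" for j
    proof -
      have "(\<Sum>i\<in>UNIV. Q $ i $ j) = (\<Sum>i\<in>{i. (i, j) \<in> E}. \<nu> $ j / d j)"
        unfolding Q_def by (simp add: sum.If_cases)
      also have "\<dots> = d j * (\<nu> $ j / d j)" by (simp only: sum_constant d_def)
      also have "\<dots> = \<nu> $ j" using d[of j] by simp
      finally show ?thesis .
    qed
    then show ?thesis by (simp add: col_sums_def vec_eq_iff)
  qed
  moreover have "pos_prob (row_sums Q)"
  proof -
    have "0 < row_sums Q $ i" for i
    proof -
      obtain j where "(i, j) \<in> E" using assms(1) by (auto simp: no_isolated_def)
      then have "0 < Q $ i $ j" using d[of j] by (simp add: Q_def)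
      then show ?thesis
        unfolding row_sums_def using plans_onD(1)[OF Q] by (auto intro!: sum_pos2[of _ j])
    qed
    then show ?thesis
      using row_sums_prob[OF Q] col assms(2) by (simp add: pos_prob_def)
  qed
  ultimately show ?thesis by (rule that)
qed

lemma plans_convex:
  assumes "Q \<in> plans_on E" "R \<in> plans_on E" "0 \<le> s" "s \<le> 1" "col_sums Q = \<nu>" "col_sums R = \<nu>"
  shows "(1 - s) *\<^sub>R Q + s *\<^sub>R R \<in> {Q \<in> plans_on E. col_sums Q = \<nu>}"
    and "row_sums ((1 - s) *\<^sub>R Q + s *\<^sub>R R) = (1 - s) *\<^sub>R row_sums Q + s *\<^sub>R row_sums R"
proof -
  have "(1 - s) *\<^sub>R Q + s *\<^sub>R R \<in> plans_on E"
    using assms(1-4) by (auto simp: plans_on_def)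
  moreover have "col_sums ((1 - s) *\<^sub>R Q + s *\<^sub>R R) = (1 - s) *\<^sub>R col_sums Q + s *\<^sub>R col_sums R"
    by (simp add: col_sums_def vec_eq_iff sum.distrib sum_distrib_left)
  ultimately show "(1 - s) *\<^sub>R Q + s *\<^sub>R R \<in> {Q \<in> plans_on E. col_sums Q = \<nu>}"
    using assms(5,6) by (simp add: algebra_simps)
  show "row_sums ((1 - s) *\<^sub>R Q + s *\<^sub>R R) = (1 - s) *\<^sub>R row_sums Q + s *\<^sub>R row_sums R"
    by (simp add: row_sums_def vec_eq_iff sum.distrib sum_distrib_left)
qed

text \<open>
  The admissible first marginals are the image of a compact convex set of plans and contain a
  positive vector, so the facts on entropy projections apply to \<open>mu_star\<close>. The second and
  third claims are its positivity and the variational inequality; the last one is uniqueness.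
\<close>

lemma mu_star_projection:
  assumes E: "no_isolated E" and \<mu>: "pos_prob \<mu>" and \<nu>: "pos_prob \<nu>"
  shows "\<exists>Q\<in>plans_on E. col_sums Q = \<nu> \<and> row_sums Q = mu_star \<mu> \<nu> E"
    and "pos_prob (mu_star \<mu> \<nu> E)"
    and "Q \<in> plans_on E \<Longrightarrow> col_sums Q = \<nu> \<Longrightarrow>
      (\<Sum>i\<in>UNIV. (row_sums Q $ i - mu_star \<mu> \<nu> E $ i) * v_star \<mu> \<nu> E $ i) \<le> 0"
    and "Q \<in> plans_on E \<Longrightarrow> col_sums Q = \<nu> \<Longrightarrow>
      rel_entropy (mu_star \<mu> \<nu> E) \<mu> \<le> rel_entropy (row_sums Q) \<mu>"
    and "Q \<in> plans_on E \<Longrightarrow> col_sums Q = \<nu> \<Longrightarrow>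
      rel_entropy (row_sums Q) \<mu> \<le> rel_entropy (mu_star \<mu> \<nu> E) \<mu> \<Longrightarrow> row_sums Q = mu_star \<mu> \<nu> E"
proof -
  let ?A = "{Q \<in> plans_on E. col_sums Q = \<nu>}"
  let ?x = "mu_star \<mu> \<nu> E"
  obtain R where R: "R \<in> plans_on E" "col_sums R = \<nu>" and Rpos: "pos_prob (row_sums R)"
    by (rule full_plan_exists[OF E \<nu>])
  have A: "?A = plans_with_columns \<nu> \<inter> {Q. \<forall>i j. (i, j) \<notin> E \<longrightarrow> Q $ i $ j = 0}"
    by (auto simp: plans_on_def plans_with_columns_def col_sums_def vec_eq_iff)
  have "closed {Q :: real ^ 'b ^ 'a. \<forall>i j. (i, j) \<notin> E \<longrightarrow> Q $ i $ j = 0}"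
    by (intro closed_Collect_all closed_Collect_imp open_Collect_const closed_Collect_eq
        continuous_on_const continuous_on_component continuous_on_id)
  then have "compact ?A" unfolding A by (rule compact_Int_closed[OF compact_plans_with_columns])
  moreover have "continuous_on ?A row_sums"
    unfolding row_sums_def
    by (intro continuous_on_vec_lambda continuous_on_sum continuous_on_component continuous_on_id)
  ultimately have cpt: "compact (row_sums ` ?A)" by (rule compact_continuous_image[rotated])
  have prob: "row_sums Q \<in> prob_simplex" if "Q \<in> plans_on E" "col_sums Q = \<nu>" for Q
    using row_sums_prob[OF that(1)] that(2) \<nu> by simp
  then have sub: "row_sums ` ?A \<subseteq> prob_simplex" by (intro image_subsetI) simp
  have "row_sums R \<in> row_sums ` ?A" using R by (intro imageI) simp
  then have ne: "row_sums ` ?A \<noteq> {}" by (metis empty_iff)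
  obtain x0 where x0: "x0 \<in> row_sums ` ?A"
      "\<forall>x\<in>row_sums ` ?A. rel_entropy x0 \<mu> \<le> rel_entropy x \<mu>"
    using continuous_attains_inf[OF cpt ne continuous_on_subset[OF continuous_on_rel_entropy[OF \<mu>] sub]]
    by (rule bexE)
  note min = arg_min_onI[where f = "\<lambda>x. rel_entropy x \<mu>", OF x0, folded mu_star_eq[OF \<nu>]]
  from min(1) obtain Q0 where "?x = row_sums Q0" "Q0 \<in> ?A" by (rule imageE)
  then have Q0: "Q0 \<in> plans_on E" "col_sums Q0 = \<nu>" "row_sums Q0 = ?x" by simp_all
  then show "\<exists>Q\<in>plans_on E. col_sums Q = \<nu> \<and> row_sums Q = ?x" by (intro bexI[of _ Q0] conjI)
  have xp: "?x \<in> prob_simplex" using prob[OF Q0(1,2)] Q0(3) by simp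
  have segment: "rel_entropy ?x \<mu> \<le> rel_entropy ((1 - s) *\<^sub>R ?x + s *\<^sub>R row_sums Q) \<mu>"
    if "Q \<in> plans_on E" "col_sums Q = \<nu>" "0 < s" "s \<le> 1" for Q s
    using min(2)[OF imageI[OF plans_convex(1)[OF Q0(1) that(1) _ that(4) Q0(2) that(2)]]]
      plans_convex(2)[OF Q0(1) that(1) _ that(4) Q0(2) that(2)] Q0(3) that(3) by simp
  show pos: "pos_prob ?x"
    by (rule entropy_projection_pos[OF \<mu> xp Rpos segment[OF R]])
  show le: "rel_entropy ?x \<mu> \<le> rel_entropy (row_sums Q) \<mu>" if "Q \<in> plans_on E" "col_sums Q = \<nu>"
    for Q by (rule min(2), rule imageI) (use that in simp)
  show var: "(\<Sum>i\<in>UNIV. (row_sums Q $ i - ?x $ i) * v_star \<mu> \<nu> E $ i) \<le> 0"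
    if Q: "Q \<in> plans_on E" "col_sums Q = \<nu>" for Q
  proof -
    from entropy_projection_variational[OF \<mu> pos prob[OF Q] segment[OF Q]]
    show ?thesis by (simp add: v_star_def)
  qed
  show "row_sums Q = ?x" if Q: "Q \<in> plans_on E" "col_sums Q = \<nu>"
    and H: "rel_entropy (row_sums Q) \<mu> \<le> rel_entropy ?x \<mu>" for Q
  proof -
    note p = prob[OF Q]
    have "rel_entropy (row_sums Q) ?x \<le> 0"
      using rel_entropy_pythagoras[OF p pos \<mu>] H var[OF Q] by (simp add: v_star_def)
    then show ?thesis using rel_entropy_nonneg[OF p pos] by force
  qed
qed

text \<open>
  Moving the whole mass of the entry \<open>(k, j)\<close> to \<open>(i, j)\<close> keeps the second marginal, so optimality
  forbids a gain: in each column an optimal plan sits on the rows of maximal velocity.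
\<close>

lemma v_star_exchange:
  assumes E: "no_isolated E" and \<mu>: "pos_prob \<mu>" and \<nu>: "pos_prob \<nu>"
    and Q: "Q \<in> plans_on E" "col_sums Q = \<nu>" "row_sums Q = mu_star \<mu> \<nu> E"
    and pos: "0 < Q $ k $ j" and edge: "(i, j) \<in> E"
  shows "v_star \<mu> \<nu> E $ i \<le> v_star \<mu> \<nu> E $ k"
proof -
  let ?q = "Q $ k $ j"
  define R where "R = (\<chi> a b. Q $ a $ b +
    (if b = j then (if a = i then ?q else 0) - (if a = k then ?q else 0) else 0))"
  have row: "row_sums R $ a = row_sums Q $ a + ((if a = i then ?q else 0) - (if a = k then ?q else 0))" for a
    by (simp add: row_sums_def R_def sum.distrib)
  have "R \<in> plans_on E"
    using plans_onD[OF Q(1)] Q(1) pos edge by (auto simp: plans_on_def R_def add_nonneg_nonneg)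
  moreover have "col_sums R $ b = col_sums Q $ b" for b
    by (cases "b = j") (simp_all add: col_sums_def R_def sum.distrib sum_subtractf)
  then have "col_sums R = \<nu>" using Q(2) by (simp add: vec_eq_iff)
  ultimately have "(\<Sum>a\<in>UNIV. (row_sums R $ a - mu_star \<mu> \<nu> E $ a) * v_star \<mu> \<nu> E $ a) \<le> 0"
    by (rule mu_star_projection(3)[OF E \<mu> \<nu>])
  moreover have "(row_sums R $ a - mu_star \<mu> \<nu> E $ a) * v_star \<mu> \<nu> E $ a
      = (if a = i then ?q * v_star \<mu> \<nu> E $ a else 0) - (if a = k then ?q * v_star \<mu> \<nu> E $ a else 0)" for a
    by (simp add: row Q(3) left_diff_distrib)
  ultimately have "?q * v_star \<mu> \<nu> E $ i - ?q * v_star \<mu> \<nu> E $ k \<le> 0"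
    by (simp add: sum_subtractf)
  then show ?thesis using pos by simp
qed

text \<open>
  Put \<open>u j = - v\<close> for the maximal velocity \<open>v\<close> in column \<open>j\<close>; these \<open>u\<close> satisfy both claims, and it
  remains to identify them with \<open>w_star\<close>. Reweighting an optimal plan by \<open>exp v\<close> gives a plan with
  first marginal \<open>\<mu>\<close> and second marginal \<open>\<nu> $ j * exp (- u j)\<close>, and the inequality \<open>v + u \<le> 0\<close> on the
  edges, with equality on its support, certifies that it solves the minimization defining \<open>nu_star\<close>.
\<close>

lemma star_complementarity:
  assumes E: "no_isolated E" and \<mu>: "pos_prob \<mu>" and \<nu>: "pos_prob \<nu>"
  shows "(i, j) \<in> E \<Longrightarrow> v_star \<mu> \<nu> E $ i + w_star \<mu> \<nu> E $ j \<le> 0"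
    and "Q \<in> plans_on E \<Longrightarrow> col_sums Q = \<nu> \<Longrightarrow> row_sums Q = mu_star \<mu> \<nu> E \<Longrightarrow> 0 < Q $ i $ j
      \<Longrightarrow> v_star \<mu> \<nu> E $ i + w_star \<mu> \<nu> E $ j = 0"
proof -
  let ?v = "v_star \<mu> \<nu> E" and ?x = "mu_star \<mu> \<nu> E"
  obtain Q0 where Q0: "Q0 \<in> plans_on E" "col_sums Q0 = \<nu>" "row_sums Q0 = ?x"
    using mu_star_projection(1)[OF E \<mu> \<nu>] by (elim bexE conjE) (rule that)
  have "\<exists>k. 0 < Q0 $ k $ j" for j
    using col_sums_pos_entry[OF Q0(1), of j] Q0(2) pos_prob_pos[OF \<nu>, of j] by metis
  then obtain k where k: "\<And>j. 0 < Q0 $ k j $ j" by metis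
  define u where "u j = - ?v $ k j" for j
  have le: "?v $ i + u j \<le> 0" if "(i, j) \<in> E" for i j
    using v_star_exchange[OF E \<mu> \<nu> Q0 k that] by (simp add: u_def)
  have eq: "?v $ i + u j = 0" if "Q \<in> plans_on E" "col_sums Q = \<nu>" "row_sums Q = ?x" "0 < Q $ i $ j" for Q i j
    using v_star_exchange[OF E \<mu> \<nu> that plans_onD(2)[OF Q0(1) k]] le[OF plans_onD(2)[OF that(1,4)]]
    by (simp add: u_def)
  define y where "y = (\<chi> j. \<nu> $ j * exp (- u j))"
  define P where "P = (\<chi> i j. Q0 $ i $ j * exp (?v $ i))"
  have P: "P \<in> plans_on E" using Q0(1) by (auto simp: plans_on_def P_def)
  have Ppos: "?v $ i + u j = 0" if "0 < P $ i $ j" for i j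
    using eq[OF Q0] that by (simp add: P_def zero_less_mult_iff)
  have "exp (?v $ i) = \<mu> $ i / ?x $ i" for i
    using pos_prob_pos[OF \<mu>] pos_prob_pos[OF mu_star_projection(2)[OF E \<mu> \<nu>]] by (simp add: v_star_def)
  moreover have "?x $ i \<noteq> 0" for i
    using pos_prob_pos[OF mu_star_projection(2)[OF E \<mu> \<nu>], of i] by simp
  moreover have "row_sums P $ i = row_sums Q0 $ i * exp (?v $ i)" for i
    by (simp add: P_def row_sums_def sum_distrib_right)
  ultimately have rowP: "row_sums P = \<mu>" by (simp add: vec_eq_iff Q0(3))
  have "P $ i $ j = Q0 $ i $ j * exp (- u j)" for i j
    using eq[OF Q0, of i j] plans_onD(1)[OF Q0(1), of i j] by (auto simp: P_def order_le_less eq_neg_iff_add_eq_0)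
  then have "col_sums P $ j = col_sums Q0 $ j * exp (- u j)" for j
    by (simp add: col_sums_def sum_distrib_right)
  then have colP: "col_sums P = y" by (simp add: vec_eq_iff Q0(2) y_def)
  have yp: "pos_prob y"
    using col_sums_prob[OF P] rowP \<mu> pos_prob_pos[OF \<nu>] by (simp add: pos_prob_def colP) (simp add: y_def)
  have logy: "ln (\<nu> $ j / y $ j) = u j" for j
    using pos_prob_pos[OF \<nu>, of j] by (simp add: y_def exp_minus inverse_eq_divide)
  have pairing: "(\<Sum>j\<in>UNIV. col_sums R $ j * u j) + (\<Sum>i\<in>UNIV. row_sums R $ i * ?v $ i)
      = (\<Sum>i\<in>UNIV. \<Sum>j\<in>UNIV. R $ i $ j * (?v $ i + u j))" for R
  proof -
    have "(\<Sum>j\<in>UNIV. col_sums R $ j * u j) = (\<Sum>i\<in>UNIV. \<Sum>j\<in>UNIV. R $ i $ j * u j)"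
      by (subst sum.swap) (simp add: col_sums_def sum_distrib_right)
    then show ?thesis by (simp add: row_sums_def sum_distrib_right sum.distrib distrib_left)
  qed
  have entropy: "rel_entropy (col_sums R) \<nu> \<ge> rel_entropy y \<nu> + rel_entropy (col_sums R) y"
    if R: "R \<in> plans_on E" "row_sums R = \<mu>" for R
  proof -
    have "R $ i $ j * (?v $ i + u j) \<le> 0" for i j
      using le[of i j] plans_onD[OF R(1), of i j]
      by (cases "R $ i $ j = 0") (auto simp: mult_nonneg_nonpos)
    then have "(\<Sum>i\<in>UNIV. \<Sum>j\<in>UNIV. R $ i $ j * (?v $ i + u j)) \<le> 0" by (intro sum_nonpos)
    moreover have "P $ i $ j * (?v $ i + u j) = 0" for i j
      using Ppos[of i j] plans_onD[OF P, of i j] by (auto simp: order_le_less)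
    then have "(\<Sum>i\<in>UNIV. \<Sum>j\<in>UNIV. P $ i $ j * (?v $ i + u j)) = 0"
      by (intro sum.neutral ballI)
    ultimately have "(\<Sum>j\<in>UNIV. col_sums R $ j * u j) \<le> (\<Sum>j\<in>UNIV. y $ j * u j)"
      using pairing[of R] pairing[of P] by (simp add: R(2) rowP colP)
    moreover have "col_sums R \<in> prob_simplex" using col_sums_prob[OF R(1)] R(2) \<mu> by simp
    note rel_entropy_pythagoras[OF this yp \<nu>]
    ultimately show ?thesis by (simp add: logy left_diff_distrib sum_subtractf)
  qed
  have yin: "y \<in> col_sums ` {Q \<in> plans_on E. row_sums Q = \<mu>}" using P rowP colP by blast
  have ymin: "\<forall>z\<in>col_sums ` {Q \<in> plans_on E. row_sums Q = \<mu>}. rel_entropy y \<nu> \<le> rel_entropy z \<nu>"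
  proof
    fix z assume "z \<in> col_sums ` {Q \<in> plans_on E. row_sums Q = \<mu>}"
    then obtain R where R: "R \<in> plans_on E" "row_sums R = \<mu>" "z = col_sums R" by blast
    then show "rel_entropy y \<nu> \<le> rel_entropy z \<nu>"
      using entropy[OF R(1,2)] rel_entropy_nonneg(1)[OF _ yp, of z] col_sums_prob[OF R(1)] \<mu> by simp
  qed
  note min = arg_min_onI[where f = "\<lambda>z. rel_entropy z \<nu>", OF yin ymin, folded nu_star_eq[OF \<mu>]]
  obtain R where R: "R \<in> plans_on E" "row_sums R = \<mu>" "nu_star \<mu> \<nu> E = col_sums R"
    using min(1) by blast
  have "col_sums R \<in> prob_simplex" using col_sums_prob[OF R(1)] R(2) \<mu> by simp
  then have "col_sums R = y"
    using entropy[OF R(1,2)] rel_entropy_nonneg[OF _ yp, of "col_sums R"] min(2)[OF yin] R(3) by force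
  then have w: "w_star \<mu> \<nu> E $ j = u j" for j by (simp add: w_star_def R(3) logy)
  show "?v $ i + w_star \<mu> \<nu> E $ j \<le> 0" if "(i, j) \<in> E" using le[OF that] by (simp add: w)
  show "?v $ i + w_star \<mu> \<nu> E $ j = 0"
    if "Q \<in> plans_on E" "col_sums Q = \<nu>" "row_sums Q = ?x" "0 < Q $ i $ j" using eq[OF that] by (simp add: w)
qed

section \<open>Number of phases\<close>

text \<open>
  An optimal plan \<open>Q\<close> of a phase lives on edges with \<open>v + w = 0\<close>, which stay in contact, so \<open>Q\<close> is
  admissible for the next edge set and the minimal entropy cannot increase. If it stayed the same,
  \<open>Q\<close> would also be optimal for the new edge set, so that \<open>v\<close>, and by complementarity on \<open>Q\<close> also
  \<open>w\<close>, would be unchanged. But the new edge \<open>(a, b)\<close> came into contact because \<open>v $ a + w $ b > 0\<close>,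
  which contradicts the inequality for the new velocities on the new edges.
\<close>

lemma cold_phase_advance:
  assumes \<mu>: "pos_prob \<mu>" and \<nu>: "pos_prob \<nu>"
    and feas: "(f, g) \<in> dual_polytope C" and cov: "no_isolated (contact_set C f g)"
    and fin: "cold_next_time C \<mu> \<nu> (t, f, g) \<noteq> \<infinity>"
    and step: "cold_step C \<mu> \<nu> (t, f, g) = (t', f', g')"
  shows "(f', g') \<in> dual_polytope C" and "no_isolated (contact_set C f' g')"
    and "rel_entropy (mu_star \<mu> \<nu> (contact_set C f' g')) \<mu> < rel_entropy (mu_star \<mu> \<nu> (contact_set C f g)) \<mu>"
proof -
  define E where "E = contact_set C f g"
  define v where "v = v_star \<mu> \<nu> E"
  define w where "w = w_star \<mu> \<nu> E"
  define r where "r i j s = f $ i + g $ j + (s - t) * (v $ i + w $ j) - C $ i $ j" for i j s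
  define S where "S = {s. t \<le> s \<and> (\<exists>i j. (i, j) \<notin> E \<and> r i j s \<ge> 0)}"
  have E: "no_isolated E" using cov by (simp add: E_def)
  have next_eq: "cold_next_time C \<mu> \<nu> (t, f, g) = Inf (ereal ` S)"
    by (simp add: cold_next_time_def Let_def S_def r_def v_def w_def E_def)
  have Sne: "S \<noteq> {}" using fin unfolding next_eq by (auto simp: top_ereal_def)
  have Sbdd: "bdd_below S" by (rule bdd_belowI[of _ t]) (simp add: S_def)
  have "Inf (ereal ` S) = ereal (Inf S)" using ereal_Inf'[OF Sbdd Sne] by simp
  then have t': "t' = Inf S" and f': "f' = f + (t' - t) *\<^sub>R v" and g': "g' = g + (t' - t) *\<^sub>R w"
    using step by (auto simp: cold_step_def Let_def next_eq E_def v_def w_def)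
  have "S = (\<Union>(i, j)\<in>-E. {s. t \<le> s \<and> 0 \<le> r i j s})" by (auto simp: S_def)
  moreover have "closed \<dots>"
    unfolding r_def
    by (intro closed_UN finite ballI) (auto intro!: closed_Collect_conj closed_Collect_le continuous_intros)
  ultimately have "t' \<in> S" unfolding t' using closed_contains_Inf[OF Sne Sbdd] by simp
  then obtain a b where ab: "t \<le> t'" "(a, b) \<notin> E" "0 \<le> r a b t'" by (auto simp: S_def)
  have neg: "r i j t < 0" if "(i, j) \<notin> E" for i j
    using that feas by (auto simp: r_def E_def contact_set_def dual_polytope_def order_le_less)
  have r_affine: "r i j s = r i j t + (s - t) * (v $ i + w $ j)" for i j s by (simp add: r_def)
  have r': "r i j t' = f' $ i + g' $ j - C $ i $ j" for i j
    by (simp add: r_def f' g' algebra_simps)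
  have tt': "t < t'" using ab neg[OF ab(2)] by (cases "t = t'") auto
  have out: "r i j t' \<le> 0" if ij: "(i, j) \<notin> E" for i j
  proof (rule ccontr)
    assume p: "\<not> r i j t' \<le> 0"
    define k where "k = v $ i + w $ j"
    have "0 < (t' - t) * k" using p neg[OF ij] r_affine[of i j t'] by (simp add: k_def)
    then have k: "0 < k" using tt' by (simp add: zero_less_mult_iff)
    \<comment> \<open>The affine function would vanish before \<open>t'\<close>, against the choice of \<open>t'\<close> as first time.\<close>
    define s where "s = t - r i j t / k"
    have "r i j s = 0" using k r_affine[of i j s] by (simp add: s_def k_def)
    moreover have "t \<le> s" using neg[OF ij] k by (simp add: s_def divide_nonpos_pos)
    ultimately have "s \<in> S" using ij unfolding S_def mem_Collect_eq by (metis order_refl)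
    then have "t' \<le> s" unfolding t' by (rule cInf_lower[OF _ Sbdd])
    then have "r i j t' \<le> r i j s" using k r_affine[of i j t'] r_affine[of i j s]
      by (simp add: k_def)
    then show False using \<open>r i j s = 0\<close> p by simp
  qed
  note compl = star_complementarity[OF E \<mu> \<nu>, folded v_def w_def]
  have inn: "r i j t = 0" if "(i, j) \<in> E" for i j using that by (simp add: r_def E_def contact_set_def)
  have le0: "r i j t' \<le> 0" for i j
  proof (cases "(i, j) \<in> E")
    case True
    then show ?thesis
      using inn[OF True] compl(1)[OF True] tt' r_affine[of i j t'] by (simp add: mult_nonneg_nonpos)
  qed (rule out)
  show feas': "(f', g') \<in> dual_polytope C" using le0 by (simp add: dual_polytope_def r')
  define E' where "E' = contact_set C f' g'"
  have E'_iff: "(i, j) \<in> E' \<longleftrightarrow> r i j t' = 0" for i j by (simp add: E'_def contact_set_def r')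
  obtain Q where Q: "Q \<in> plans_on E" "col_sums Q = \<nu>" "row_sums Q = mu_star \<mu> \<nu> E"
    using mu_star_projection(1)[OF E \<mu> \<nu>] by (elim bexE conjE) (rule that)
  have supp: "(i, j) \<in> E'" if "0 < Q $ i $ j" for i j
    using inn[OF plans_onD(2)[OF Q(1) that]] compl(2)[OF Q that] r_affine[of i j t'] by (simp add: E'_iff)
  have E': "no_isolated E'"
    unfolding no_isolated_def
  proof (intro conjI allI)
    fix i
    have "0 < row_sums Q $ i" using pos_prob_pos[OF mu_star_projection(2)[OF E \<mu> \<nu>]] Q(3) by simp
    then show "\<exists>j. (i, j) \<in> E'" using supp row_sums_pos_entry[OF Q(1)] by metis
  next
    fix j
    have "0 < col_sums Q $ j" using pos_prob_pos[OF \<nu>] Q(2) by simp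
    then show "\<exists>i. (i, j) \<in> E'" using supp col_sums_pos_entry[OF Q(1)] by metis
  qed
  then show "no_isolated (contact_set C f' g')" by (simp add: E'_def)
  have Q': "Q \<in> plans_on E'"
    using Q(1) supp by (auto simp: plans_on_def order_le_less)
  note proj' = mu_star_projection[OF E' \<mu> \<nu>]
  have "rel_entropy (mu_star \<mu> \<nu> E') \<mu> \<noteq> rel_entropy (mu_star \<mu> \<nu> E) \<mu>"
  proof
    assume "rel_entropy (mu_star \<mu> \<nu> E') \<mu> = rel_entropy (mu_star \<mu> \<nu> E) \<mu>"
    then have eq: "row_sums Q = mu_star \<mu> \<nu> E'" using proj'(5)[OF Q' Q(2)] Q(3) by simp
    then have v': "v_star \<mu> \<nu> E' = v" using Q(3) by (simp add: v_def v_star_def)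
    obtain i where i: "0 < Q $ i $ b"
      using col_sums_pos_entry[OF Q(1), of b] Q(2) pos_prob_pos[OF \<nu>] by metis
    have "w_star \<mu> \<nu> E' $ b = w $ b"
      using compl(2)[OF Q i] star_complementarity(2)[OF E' \<mu> \<nu> Q' Q(2) eq i] v' by simp
    moreover have "(a, b) \<in> E'" using ab(3) le0[of a b] by (simp add: E'_iff)
    then have "v $ a + w_star \<mu> \<nu> E' $ b \<le> 0" using star_complementarity(1)[OF E' \<mu> \<nu>] v' by metis
    moreover have "0 < (t' - t) * (v $ a + w $ b)"
      using ab(3) neg[OF ab(2)] r_affine[of a b t'] by simp
    then have "0 < v $ a + w $ b" using tt' by (simp add: zero_less_mult_iff)
    ultimately show False by simp
  qed
  then show "rel_entropy (mu_star \<mu> \<nu> (contact_set C f' g')) \<mu> < rel_entropy (mu_star \<mu> \<nu> (contact_set C f g)) \<mu>"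
    using proj'(4)[OF Q' Q(2)] Q(3) by (simp add: E'_def E_def)
qed

lemma cold_init_feasible:
  shows "cold_init C g \<in> dual_polytope C"
    and "no_isolated (contact_set C (fst (cold_init C g)) (snd (cold_init C g)))"
proof -
  define f where "f = f_hard C g"
  define h where "h = g_hard C f"
  have init: "cold_init C g = (f, h)" by (simp add: cold_init_def f_def h_def)
  have h_le: "h $ j \<le> C $ i $ j - f $ i" for i j by (simp add: h_def g_hard_def)
  have f_le: "f $ i \<le> C $ i $ j - g $ j" for i j by (simp add: f_def f_hard_def)
  have h_ex: "\<exists>i. h $ j = C $ i $ j - f $ i" for j
    using MIN_attained[of "\<lambda>i. C $ i $ j - f $ i"] by (simp add: h_def g_hard_def)
  have f_ex: "\<exists>j. f $ i = C $ i $ j - g $ j" for i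
    using MIN_attained[of "\<lambda>j. C $ i $ j - g $ j"] by (simp add: f_def f_hard_def)
  show "cold_init C g \<in> dual_polytope C" using h_le by (simp add: init dual_polytope_def le_diff_eq add.commute)
  have "\<exists>j. f $ i + h $ j = C $ i $ j" for i
  proof -
    obtain j where j: "f $ i = C $ i $ j - g $ j" using f_ex by blast
    obtain k where "h $ j = C $ k $ j - f $ k" using h_ex by blast
    then have "g $ j \<le> h $ j" using f_le[of k j] by simp
    then have "f $ i + h $ j = C $ i $ j" using j h_le[of j i] by simp
    then show ?thesis ..
  qed
  moreover have "\<exists>i. f $ i + h $ j = C $ i $ j" for j using h_ex[of j] by (auto simp: algebra_simps)
  ultimately show "no_isolated (contact_set C (fst (cold_init C g)) (snd (cold_init C g)))"
    by (simp add: init no_isolated_def contact_set_def)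
qed

text \<open>
  Minimal entropies strictly decrease from phase to phase, so the contact sets are pairwise distinct.
\<close>

lemma cold_num_phases_le:
  fixes C :: "real ^ 'n::finite ^ 'm::finite"
  assumes \<mu>: "pos_prob \<mu>" and \<nu>: "pos_prob \<nu>"
  shows "cold_num_phases C \<mu> \<nu> (cold_init C g) \<le> card (UNIV :: ('m \<times> 'n) set set)"
proof -
  let ?N = "card (UNIV :: ('m \<times> 'n) set set)"
  let ?ph = "cold_phase C \<mu> \<nu> (cold_init C g)"
  define E where "E l = contact_set C (fst (snd (?ph l))) (snd (snd (?ph l)))" for l
  define H where "H l = rel_entropy (mu_star \<mu> \<nu> (E l)) \<mu>" for l
  have "\<exists>l\<le>?N. cold_next_time C \<mu> \<nu> (?ph l) = \<infinity>"
  proof (rule ccontr)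
    assume "\<not> (\<exists>l\<le>?N. cold_next_time C \<mu> \<nu> (?ph l) = \<infinity>)"
    then have fin: "cold_next_time C \<mu> \<nu> (?ph l) \<noteq> \<infinity>" if "l \<le> ?N" for l using that by blast
    have inv: "snd (?ph l) \<in> dual_polytope C \<and> no_isolated (E l)" if "l \<le> ?N" for l
      using that
    proof (induction l)
      case 0
      then show ?case using cold_init_feasible[of C g] by (simp add: E_def)
    next
      case (Suc l)
      obtain t f h where ph: "?ph l = (t, f, h)" by (metis prod_cases3)
      obtain t' f' h' where st: "cold_step C \<mu> \<nu> (t, f, h) = (t', f', h')" by (metis prod_cases3)
      show ?case
        using cold_phase_advance(1,2)[OF \<mu> \<nu> _ _ _ st] Suc fin[of l] by (simp add: ph st E_def)
    qed
    have dec: "H (Suc l) < H l" if "l < ?N" for l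
    proof -
      obtain t f h where ph: "?ph l = (t, f, h)" by (metis prod_cases3)
      obtain t' f' h' where st: "cold_step C \<mu> \<nu> (t, f, h) = (t', f', h')" by (metis prod_cases3)
      show ?thesis
        using cold_phase_advance(3)[OF \<mu> \<nu> _ _ _ st] inv[of l] fin[of l] that
        by (simp add: ph st E_def H_def)
    qed
    have less: "H k < H l" if "l < k" "k \<le> ?N" for k l
      using that
    proof (induction k)
      case (Suc k)
      then show ?case using dec[of k] by (cases "l = k") auto
    qed simp
    have "inj_on E {..?N}"
    proof (rule inj_onI)
      fix k l assume "k \<in> {..?N}" "l \<in> {..?N}" "E k = E l"
      then show "k = l" using less[of k l] less[of l k] by (cases k l rule: linorder_cases) (auto simp: H_def)
    qed
    then have "card {..?N} \<le> ?N" by (intro card_inj_on_le[of E]) auto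
    then show False by simp
  qed
  then obtain l where "l \<le> ?N" "cold_next_time C \<mu> \<nu> (?ph l) = \<infinity>" by blast
  then show ?thesis
    unfolding cold_num_phases_def by (meson Least_le order_trans)
qed

section \<open>Convergence in order 1 / tau steps\<close>

lemma ln_power_ge:
  fixes \<tau> :: real
  assumes "0 < \<tau>" "\<tau> \<le> \<tau>max" "\<tau>max < 1" "L \<le> N"
  shows "min 1 (ln (1 / \<tau>max)) ^ (2 * N + 1) \<le> ln (1 / \<tau>) ^ (2 * L + 1)"
proof -
  let ?c = "min 1 (ln (1 / \<tau>max))"
  have c: "0 \<le> ?c" using assms by simp
  have "ln (1 / \<tau>max) \<le> ln (1 / \<tau>)" using assms by (simp add: ln_div)
  then have le: "?c \<le> ln (1 / \<tau>)" by simp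
  have "?c ^ (2 * N + 1) \<le> ?c ^ (2 * L + 1)" using c assms(4) by (intro power_decreasing) auto
  also have "\<dots> \<le> ln (1 / \<tau>) ^ (2 * L + 1)" by (rule power_mono[OF le c])
  finally show ?thesis .
qed

theorem theorem4p3:
  fixes \<mu> :: "real ^ 'm::finite" and \<nu> :: "real ^ 'n::finite" and C :: "real ^ 'n ^ 'm"
    and \<tau>max :: real
  assumes "\<mu> \<in> prob_simplex" and "\<And>i. 0 < \<mu> $ i"
    and "\<nu> \<in> prob_simplex" and "\<And>j. 0 < \<nu> $ j"
    and "0 < \<tau>max" and "\<tau>max < 1"
  shows "(\<exists>T B :: real. \<forall>\<tau> f0 g0. \<forall>k :: nat.
            0 < \<tau> \<and> \<tau> \<le> \<tau>max \<and> real k \<ge> T / \<tau> \<longrightarrow>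
              Psi C \<mu> \<nu> \<tau> (sinkhorn C \<mu> \<nu> \<tau> (f0, g0) k) - (INF p. Psi C \<mu> \<nu> \<tau> p)
              \<le> B * \<tau> * ln (1 / \<tau>) ^ (2 * cold_num_phases C \<mu> \<nu> (cold_init C g0) + 1))
       \<and> (\<forall>f0 g0. \<exists>T' B' B'' :: real. T' > 0 \<and> B' > 0 \<and> B'' > 0 \<and>
            (cold_init C g0 \<in> argmin_Psi0 C \<mu> \<nu> \<or>
             (\<forall>\<tau>. \<forall>k :: nat. 0 < \<tau> \<and> \<tau> \<le> \<tau>max \<and> real k \<le> T' / \<tau> \<longrightarrow>
              Psi C \<mu> \<nu> \<tau> (sinkhorn C \<mu> \<nu> \<tau> (f0, g0) k) - (INF p. Psi C \<mu> \<nu> \<tau> p)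
              \<ge> B' - B'' * \<tau> * ln (1 / \<tau>) ^ (2 * cold_num_phases C \<mu> \<nu> (cold_init C g0) + 1))))"
proof -
  have \<mu>: "pos_prob \<mu>" and \<nu>: "pos_prob \<nu>" using assms by (auto simp: pos_prob_def)
  define L where "L g = cold_num_phases C \<mu> \<nu> (cold_init C g)" for g
  define N where "N = card (UNIV :: ('m \<times> 'n) set set)"
  define \<kappa> where "\<kappa> = min 1 (ln (1 / \<tau>max)) ^ (2 * N + 1)"
  have \<kappa>: "0 < \<kappa>" using assms(5,6) by (simp add: \<kappa>_def)
  have absorb: "B * \<tau> \<le> B / \<kappa> * \<tau> * ln (1 / \<tau>) ^ (2 * L g + 1)"
    if "0 \<le> B" "0 < \<tau>" "\<tau> \<le> \<tau>max" for B \<tau> g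
  proof -
    have "\<kappa> \<le> ln (1 / \<tau>) ^ (2 * L g + 1)"
      unfolding \<kappa>_def L_def N_def
      by (rule ln_power_ge[OF that(2,3) assms(6) cold_num_phases_le[OF \<mu> \<nu>]])
    then have "B / \<kappa> * \<tau> * \<kappa> \<le> B / \<kappa> * \<tau> * ln (1 / \<tau>) ^ (2 * L g + 1)"
      using that \<kappa> by (intro mult_left_mono) auto
    then show ?thesis using \<kappa> by simp
  qed
  have upper: "\<exists>T B. \<forall>\<tau> f0 g0. \<forall>k :: nat. 0 < \<tau> \<and> \<tau> \<le> \<tau>max \<and> real k \<ge> T / \<tau> \<longrightarrow>
      Psi C \<mu> \<nu> \<tau> (sinkhorn C \<mu> \<nu> \<tau> (f0, g0) k) - (INF p. Psi C \<mu> \<nu> \<tau> p)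
        \<le> B * \<tau> * ln (1 / \<tau>) ^ (2 * L g0 + 1)"
  proof -
    obtain T B where B: "0 \<le> B" and gap: "\<And>\<tau> p k. 0 < \<tau> \<Longrightarrow> \<tau> \<le> 1 \<Longrightarrow> T / \<tau> \<le> real k \<Longrightarrow>
        Psi C \<mu> \<nu> \<tau> (sinkhorn C \<mu> \<nu> \<tau> p k) - (INF q. Psi C \<mu> \<nu> \<tau> q) \<le> B * \<tau>"
      by (rule sinkhorn_gap_le[OF \<mu> \<nu>, where C = C]) (rule that)
    show ?thesis
    proof (intro exI allI impI)
      fix \<tau> f0 g0 and k :: nat
      assume h: "0 < \<tau> \<and> \<tau> \<le> \<tau>max \<and> real k \<ge> T / \<tau>"
      then have "\<tau> \<le> 1" using assms(6) by linarith
      then show "Psi C \<mu> \<nu> \<tau> (sinkhorn C \<mu> \<nu> \<tau> (f0, g0) k) - (INF p. Psi C \<mu> \<nu> \<tau> p)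
          \<le> B / \<kappa> * \<tau> * ln (1 / \<tau>) ^ (2 * L g0 + 1)"
        using gap[of \<tau> k "(f0, g0)"] absorb[OF B, of \<tau> g0] h by linarith
    qed
  qed
  have lower: "\<exists>T' B' B''. T' > 0 \<and> B' > 0 \<and> B'' > 0 \<and>
      (cold_init C g0 \<in> argmin_Psi0 C \<mu> \<nu> \<or>
       (\<forall>\<tau>. \<forall>k :: nat. 0 < \<tau> \<and> \<tau> \<le> \<tau>max \<and> real k \<le> T' / \<tau> \<longrightarrow>
          Psi C \<mu> \<nu> \<tau> (sinkhorn C \<mu> \<nu> \<tau> (f0, g0) k) - (INF p. Psi C \<mu> \<nu> \<tau> p)
          \<ge> B' - B'' * \<tau> * ln (1 / \<tau>) ^ (2 * L g0 + 1)))" for f0 g0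
  proof (cases "cold_init C g0 \<in> argmin_Psi0 C \<mu> \<nu>")
    case True
    then show ?thesis by (intro exI[of _ 1]) simp
  next
    case False
    then obtain q where q: "q \<in> dual_polytope C" "Psi0 \<mu> \<nu> q < Psi0 \<mu> \<nu> (cold_init C g0)"
      using cold_init_feasible(1)[of C g0] by (auto simp: argmin_Psi0_def is_arg_min_def)
    obtain T B D where pos: "0 < T" "0 < B" "0 < D" and gap: "\<And>\<tau> k. 0 < \<tau> \<Longrightarrow> real k \<le> T / \<tau> \<Longrightarrow>
        B - D * \<tau> \<le> Psi C \<mu> \<nu> \<tau> (sinkhorn C \<mu> \<nu> \<tau> (f0, g0) k) - (INF p. Psi C \<mu> \<nu> \<tau> p)"
      by (rule sinkhorn_gap_ge[OF \<mu> \<nu> q, where ?f0.0 = f0]) (rule that)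
    have "Psi C \<mu> \<nu> \<tau> (sinkhorn C \<mu> \<nu> \<tau> (f0, g0) k) - (INF p. Psi C \<mu> \<nu> \<tau> p)
        \<ge> B - D / \<kappa> * \<tau> * ln (1 / \<tau>) ^ (2 * L g0 + 1)"
      if h: "0 < \<tau> \<and> \<tau> \<le> \<tau>max \<and> real k \<le> T / \<tau>" for \<tau> and k :: nat
      using gap[of \<tau> k] absorb[OF less_imp_le[OF pos(3)], of \<tau> g0] h by linarith
    moreover have "0 < D / \<kappa>" using pos \<kappa> by simp
    ultimately show ?thesis using pos by (intro exI[of _ T] exI[of _ B] exI[of _ "D / \<kappa>"]) simp
  qed
  show ?thesis using upper lower unfolding L_def by (intro conjI allI)
qed

end
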